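(* Let $\{x_t\}$ be generated by the SA2GD algorithm (see context) with integers $n_a, n_b \ge 1$, and suppose the assumptions listed in the context hold: bounded feasible region (diameter bound $\Theta$), Lipschitz continuous gradients (constants $L_a, L_b$), strong convexity (constants $c_a, c_b$), and unbiased stochastic gradients with second-moment bounds (constants $G_i, \bar G_i$). Let $\lambda_* = n_a/(n_a+n_b)$ and let $x_*$ be the unique minimizer of $S(\cdot,\lambda_* )$ in $\mathcal{X}$. Set $c = \min(c_a,c_b)$, $L = \max(L_a,L_b)$, $G = \max(G_a,G_b)$, $\bar G = \max(\bar G_a,\bar G_b)$, $M_\nabla = \max(M_\nabla^a, M_\nabla^b)$, and $\hat G = \sqrt{G + \bar G M_\nabla}$. If the step sizes are $\alpha_t = \frac{2}{c(t+1)(n_a+n_b)}$, then $$\min_{t=1,\ldots,T} \mathbb{E}[S(x_t,\lambda_* )] - S(x_*,\lambda_* ) \;\le\; \frac{4}{c(T+1)}\left(\hat G^2 + L\Theta\hat G\right).$$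
   Context: Problem: minimize the pair $(f^a(x), f^b(x))$ over $x \in \mathcal{X}$, where $\mathcal{X} \subset \mathbb{R}^n$ is nonempty, compact and convex and the real-valued functions $f^a, f^b$ are continuously differentiable. For $\lambda \in [0,1]$, $S(x,\lambda) = \lambda f^a(x) + (1-\lambda) f^b(x)$. $P_{\mathcal{X}}$ is the orthogonal projection onto $\mathcal{X}$; $\|\cdot\|$ is the Euclidean norm. SA2GD algorithm: given an initial point $x_0$, step sizes $\alpha_t>0$, and independently drawn random variables $\xi_t^r$ ($0 \le r \le n_a+n_b-1$), at each iteration $t = 0,1,2,\ldots$ set $y^a_{0,t} = x_t$; for $r=0,\ldots,n_a-1$ set $y^a_{r+1,t} = y^a_{r,t} - \alpha_t g^a(y^a_{r,t},\xi^r_t)$; set $y^b_{0,t} = y^a_{n_a,t}$; for $r=0,\ldots,n_b-1$ set $y^b_{r+1,t} = y^b_{r,t} - \alpha_t g^b(y^b_{r,t},\xi^{n_a+r}_t)$; finally $x_{t+1} = P_{\mathcal{X}}(y^b_{n_b,t})$. Here $g^i(x,\xi)$ is a stochastic gradient (an unbiased estimator of the gradient) of $f^i$ at $x$, generated with the random variable $\xi$. Assumptions (for $i \in \{a,b\}$): - Bounded feasible region: $\max_{x,\bar x\in\mathcal{X}}\|x-\bar x\| \le \Theta < \infty$, $\Theta>0$. - Lipschitz gradients: $\|\nabla f^i(x) - \nabla f^i(\bar x)\| \le L_i\|x-\bar x\|$ for all $(x,\bar x)\in\mathcal{X}\times\mathcal{X}$, $L_i>0$. The constant $M_\nabla^i>0$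 is such that $\|\nabla f^i(x)\|^2 \le M_\nabla^i$ for all $x\in\mathcal{X}$ (it exists since $\nabla f^i$ is continuous and $\mathcal{X}$ is compact). - Strong convexity: $f^i(\bar x) \ge f^i(x) + \nabla f^i(x)^\top(\bar x - x) + \frac{c_i}{2}\|\bar x - x\|^2$ for all $(x,\bar x)\in\mathcal{X}\times\mathcal{X}$, $c_i>0$. - Stochastic gradients: for all iterates $t\in\mathbb{N}$, the stochastic gradients $g^i(x_t,\xi_t)$, generated with random variable $\xi_t$, satisfy $\mathbb{E}_{\xi_t}[g^i(x_t,\xi_t)] = \nabla f^i(x_t)$ and $\mathbb{E}_{\xi_t}[\|g^i(x_t,\xi_t)\|^2] \le G_i + \bar G_i\|\nabla f^i(x_t)\|^2$, with $G_i,\bar G_i>0$, where $\mathbb{E}_{\xi_t}$ is the conditional expectation with respect to $\xi_t$.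
   Formalization: Added: almost surely, the Lipschitz gradient bound (same L_i) also holds between points of X and the inner iterates where gradients are sampled, which may leave X; the stochastic gradient assumption is imposed at those sampled iterates. With Lipschitz continuity on X only, the claim is false. *)

theory Defs
  imports "HOL-Probability.Probability"
begin

text \<open>The superscript \<open>i \<in> {a, b}\<close> that labels the two objective functions and their constants.\<close>

datatype objective = Obj_a | Obj_b

definition weighted_sum :: "(objective \<Rightarrow> 'a \<Rightarrow> real) \<Rightarrow> 'a \<Rightarrow> real \<Rightarrow> real" where
  "weighted_sum f v l = l * f Obj_a v + (1 - l) * f Obj_b v"

text \<open>
  One realisation of the algorithm: \<open>z t r\<close> is the value of the random variable \<open>\<xi>\<close>
  drawn for step \<open>r\<close> of iteration \<open>t\<close>, \<open>x t\<close> is the outer iterate and \<open>y i t r\<close> is the inner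
  iterate \<open>y\<^sup>i\<^bsub>r,t\<^esub>\<close>.  The inner iterates are not projected, so they may leave \<open>X\<close>.
\<close>

definition sa2gd_run ::
    "'a::euclidean_space set \<Rightarrow> (objective \<Rightarrow> 'a \<Rightarrow> 'z \<Rightarrow> 'a) \<Rightarrow> (objective \<Rightarrow> nat) \<Rightarrow> (nat \<Rightarrow> real)
      \<Rightarrow> (nat \<Rightarrow> nat \<Rightarrow> 'z) \<Rightarrow> 'a \<Rightarrow> (nat \<Rightarrow> 'a) \<Rightarrow> (objective \<Rightarrow> nat \<Rightarrow> nat \<Rightarrow> 'a) \<Rightarrow> bool" where
  "sa2gd_run X g n \<alpha> z x0 x y \<longleftrightarrow>
     x 0 = x0 \<and>
     (\<forall>t. y Obj_a t 0 = x t \<and>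
          (\<forall>r<n Obj_a. y Obj_a t (Suc r)
             = y Obj_a t r - \<alpha> t *\<^sub>R g Obj_a (y Obj_a t r) (z t r)) \<and>
          y Obj_b t 0 = y Obj_a t (n Obj_a) \<and>
          (\<forall>r<n Obj_b. y Obj_b t (Suc r)
             = y Obj_b t r - \<alpha> t *\<^sub>R g Obj_b (y Obj_b t r) (z t (n Obj_a + r))) \<and>
          x (Suc t) = closest_point X (y Obj_b t (n Obj_b)))"

text \<open>
  The stochastic-gradient condition at a point \<open>v\<close>, for the gradient estimator \<open>g\<close> driven by the
  random variable \<open>\<xi>\<close>.  The expectation is over \<open>\<xi>\<close> only; substituting an iterate of the
  algorithm, which is independent of the \<open>\<xi>\<close> drawn at that step, for \<open>v\<close> gives the conditional
  expectation \<open>E\<^sub>\<xi>\<close>.  Integrability is required explicitly because the integral of a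
  non-integrable function is 0 by convention.
\<close>

definition stochastic_gradient_at ::
    "'w measure \<Rightarrow> ('w \<Rightarrow> 'z) \<Rightarrow> ('a::euclidean_space \<Rightarrow> 'z \<Rightarrow> 'a) \<Rightarrow> ('a \<Rightarrow> 'a)
      \<Rightarrow> real \<Rightarrow> real \<Rightarrow> 'a \<Rightarrow> bool" where
  "stochastic_gradient_at M \<xi> g df G Gbar v \<longleftrightarrow>
     integrable M (\<lambda>\<omega>. g v (\<xi> \<omega>)) \<and>
     (\<integral>\<omega>. g v (\<xi> \<omega>) \<partial>M) = df v \<and>
     integrable M (\<lambda>\<omega>. (norm (g v (\<xi> \<omega>)))\<^sup>2) \<and>
     (\<integral>\<omega>. (norm (g v (\<xi> \<omega>)))\<^sup>2 \<partial>M) \<le> G + Gbar * (norm (df v))\<^sup>2"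

end

theory Submission
  imports Defs
begin

text \<open>
  Let \<open>e t = E[S(x\<^sub>t)] - S(x\<^sub>*)\<close>, \<open>D t = E\<parallel>x\<^sub>t - x\<^sub>*\<parallel>\<^sup>2\<close>, \<open>m = sqrt Mgrad\<close>, \<open>N = n\<^sub>a + n\<^sub>b\<close>,
  \<open>\<beta> t = N \<alpha> t\<close> and \<open>B = Ghat\<^sup>2 + L \<Theta> Ghat\<close>.  The textbook argument gives
  \<open>D (t + 1) \<le> D t - 2 \<beta> t (e t + c/2 D t) + (\<beta> t)\<^sup>2 B\<close>, provided every stochastic gradient has root mean
  square at most \<open>Ghat\<close>.  Outside \<open>X\<close>, where inner iterates may lie, this bound fails: there the root
  mean square is only bounded by \<open>Ghat + \<sigma> L \<parallel>y - x\<^sub>t\<parallel>\<close>, where \<open>\<sigma> = max 1 (sqrt Gbar)\<close> if \<open>m \<le> Ghat\<close>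
  and \<open>\<sigma> = 0\<close> otherwise.  The displacements then grow at most geometrically, and as long as
  \<open>\<beta> t \<sigma> L \<le> 1/2\<close>, that is \<open>t + 1 \<ge> 4 L \<sigma> / c\<close>, this costs a factor below 2 in front of \<open>B\<close>, which the
  constant 4 of the theorem (against 2 in the textbook argument) leaves room for.

  For the earlier iterations strong convexity gives \<open>e t \<le> m \<Theta> - c/2 D t\<close>, and \<open>\<sigma> m \<le> Ghat\<close> makes
  \<open>m \<Theta> \<le> 4 B / (c (t + 1))\<close> as long as \<open>t + 1 \<le> 4 L \<sigma> / c\<close>.  The two regimes fit together exactly: if
  \<open>\<mu> \<le> e t\<close> for all \<open>t\<close>, then \<open>t (t - 1) / 2 \<mu> + c t (t - 1) / 4 D t \<le> 2 (t - 1) B / c\<close> holds at the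
  threshold by the second estimate and propagates by the recursion.
\<close>

section \<open>Square-integrable functions\<close>

text \<open>The bounds \<open>A\<close> and \<open>B\<close> on the root mean squares are free
  parameters, so that inductive estimates can be inserted directly. For positive bounds this is the
  weighted inequality \<open>2 * a * b \<le> (B / A) * a\<^sup>2 + (A / B) * b\<^sup>2\<close>,
  integrated.\<close>

lemma Cauchy_Schwarz_integral:
  fixes a b :: "'w \<Rightarrow> real"
  assumes [measurable]: "a \<in> borel_measurable M" "b \<in> borel_measurable M"
    and int: "integrable M (\<lambda>\<omega>. (a \<omega>)\<^sup>2)" "integrable M (\<lambda>\<omega>. (b \<omega>)\<^sup>2)"
    and le: "(\<integral>\<omega>. (a \<omega>)\<^sup>2 \<partial>M) \<le> A\<^sup>2" "(\<integral>\<omega>. (b \<omega>)\<^sup>2 \<partial>M) \<le> B\<^sup>2"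
    and nonneg: "A \<ge> 0" "B \<ge> 0"
  shows "integrable M (\<lambda>\<omega>. a \<omega> * b \<omega>)" "(\<integral>\<omega>. a \<omega> * b \<omega> \<partial>M) \<le> A * B"
proof -
  show i: "integrable M (\<lambda>\<omega>. a \<omega> * b \<omega>)"
  proof (rule Bochner_Integration.integrable_bound)
    show "integrable M (\<lambda>\<omega>. (a \<omega>)\<^sup>2 + (b \<omega>)\<^sup>2)"
      using int by simp
    have "\<bar>s * t\<bar> \<le> s\<^sup>2 + t\<^sup>2" for s t :: real
      using sum_squares_bound[of "\<bar>s\<bar>" "\<bar>t\<bar>"] mult_nonneg_nonneg[of "\<bar>s\<bar>" "\<bar>t\<bar>"]
      unfolding abs_mult power2_abs by linarith
    then show "AE \<omega> in M. norm (a \<omega> * b \<omega>) \<le> norm ((a \<omega>)\<^sup>2 + (b \<omega>)\<^sup>2)"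
      by (intro AE_I2) (simp add: abs_mult)
  qed simp
  show "(\<integral>\<omega>. a \<omega> * b \<omega> \<partial>M) \<le> A * B"
  \<comment> \<open>The weights \<open>B / A\<close> and \<open>A / B\<close> make sense only for
    nonzero bounds. If one bound is 0, that factor vanishes almost everywhere, and so does the
    product.\<close>
  proof (cases "A = 0 \<or> B = 0")
    case True
    have z: "AE \<omega> in M. h \<omega> = 0" if "integrable M (\<lambda>\<omega>. (h \<omega>)\<^sup>2)" "(\<integral>\<omega>. (h \<omega>)\<^sup>2 \<partial>M) \<le> 0"
      for h :: "'w \<Rightarrow> real"
    proof -
      have "(\<integral>\<omega>. (h \<omega>)\<^sup>2 \<partial>M) = 0"
        using that(2) by (intro antisym) auto
      then show ?thesis
        using integral_nonneg_eq_0_iff_AE[OF that(1)] by simp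
    qed
    from True have "AE \<omega> in M. a \<omega> * b \<omega> = 0"
    proof
      assume "A = 0"
      then have "AE \<omega> in M. a \<omega> = 0" using z[of a] int le by simp
      then show ?thesis by eventually_elim simp
    next
      assume "B = 0"
      then have "AE \<omega> in M. b \<omega> = 0" using z[of b] int le by simp
      then show ?thesis by eventually_elim simp
    qed
    then have "(\<integral>\<omega>. a \<omega> * b \<omega> \<partial>M) = 0"
      using integral_cong_AE[of "\<lambda>\<omega>. a \<omega> * b \<omega>" M "\<lambda>_. 0"] by simp
    then show ?thesis using nonneg by simp
  next
    case False
    then have pos: "A > 0" "B > 0" using nonneg by auto
    have "(\<integral>\<omega>. a \<omega> * b \<omega> \<partial>M) \<le> (\<integral>\<omega>. (B / A) / 2 * (a \<omega>)\<^sup>2 + (A / B) / 2 * (b \<omega>)\<^sup>2 \<partial>M)"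
    proof (rule integral_mono[OF i])
      show "integrable M (\<lambda>\<omega>. (B / A) / 2 * (a \<omega>)\<^sup>2 + (A / B) / 2 * (b \<omega>)\<^sup>2)"
        using int by simp
      fix \<omega>
      have "0 \<le> (B * a \<omega> - A * b \<omega>)\<^sup>2 / (2 * A * B)"
        using pos by simp
      also have "\<dots> = (B / A) / 2 * (a \<omega>)\<^sup>2 + (A / B) / 2 * (b \<omega>)\<^sup>2 - a \<omega> * b \<omega>"
        using pos by (simp add: field_simps power2_eq_square)
      finally show "a \<omega> * b \<omega> \<le> (B / A) / 2 * (a \<omega>)\<^sup>2 + (A / B) / 2 * (b \<omega>)\<^sup>2" by simp
    qed
    also have "\<dots> = (B / A) / 2 * (\<integral>\<omega>. (a \<omega>)\<^sup>2 \<partial>M) + (A / B) / 2 * (\<integral>\<omega>. (b \<omega>)\<^sup>2 \<partial>M)"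
      using int by simp
    also have "\<dots> \<le> (B / A) / 2 * A\<^sup>2 + (A / B) / 2 * B\<^sup>2"
      using le pos by (intro add_mono mult_left_mono) auto
    also have "\<dots> = A * B"
      using pos by (simp add: field_simps power2_eq_square)
    finally show ?thesis .
  qed
qed

text \<open>Expanding the square and applying Cauchy-Schwarz to the cross term; in this form root
  mean square bounds simply add up.\<close>

lemma Minkowski_integral_power2:
  fixes a b :: "'w \<Rightarrow> real"
  assumes [measurable]: "a \<in> borel_measurable M" "b \<in> borel_measurable M"
    and int: "integrable M (\<lambda>\<omega>. (a \<omega>)\<^sup>2)" "integrable M (\<lambda>\<omega>. (b \<omega>)\<^sup>2)"
    and le: "(\<integral>\<omega>. (a \<omega>)\<^sup>2 \<partial>M) \<le> A\<^sup>2" "(\<integral>\<omega>. (b \<omega>)\<^sup>2 \<partial>M) \<le> B\<^sup>2"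
    and nonneg: "A \<ge> 0" "B \<ge> 0"
  shows "integrable M (\<lambda>\<omega>. (a \<omega> + b \<omega>)\<^sup>2)" "(\<integral>\<omega>. (a \<omega> + b \<omega>)\<^sup>2 \<partial>M) \<le> (A + B)\<^sup>2"
proof -
  note ab = Cauchy_Schwarz_integral[OF assms]
  have i2: "integrable M (\<lambda>\<omega>. 2 * (a \<omega> * b \<omega>))"
    using ab(1) by simp
  have eq: "(\<lambda>\<omega>. (a \<omega> + b \<omega>)\<^sup>2) = (\<lambda>\<omega>. ((a \<omega>)\<^sup>2 + (b \<omega>)\<^sup>2) + 2 * (a \<omega> * b \<omega>))"
    by (simp add: power2_sum algebra_simps fun_eq_iff)
  show "integrable M (\<lambda>\<omega>. (a \<omega> + b \<omega>)\<^sup>2)"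
    unfolding eq using int i2 by (intro Bochner_Integration.integrable_add)
  have "(\<integral>\<omega>. (a \<omega> + b \<omega>)\<^sup>2 \<partial>M)
      = (\<integral>\<omega>. (a \<omega>)\<^sup>2 \<partial>M) + (\<integral>\<omega>. (b \<omega>)\<^sup>2 \<partial>M) + 2 * (\<integral>\<omega>. a \<omega> * b \<omega> \<partial>M)"
    unfolding eq using int ab(1)
    by (subst Bochner_Integration.integral_add) (auto simp: i2)
  also have "\<dots> \<le> (A + B)\<^sup>2"
    using le ab(2) by (simp add: power2_sum)
  finally show "(\<integral>\<omega>. (a \<omega> + b \<omega>)\<^sup>2 \<partial>M) \<le> (A + B)\<^sup>2" .
qed

section \<open>Independence of the past\<close>

text \<open>The sigma-algebra generated by the samples with index in \<open>A\<close>, encoded as a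
  pull-back of the product sigma-algebra. Measurability with respect to it expresses that a quantity
  depends on these samples only.\<close>

definition history :: "'w measure \<Rightarrow> 'z measure \<Rightarrow> ('i \<Rightarrow> 'w \<Rightarrow> 'z) \<Rightarrow> 'i set \<Rightarrow> 'w measure" where
  "history M Z \<xi> A = vimage_algebra (space M) (\<lambda>\<omega>. \<lambda>j\<in>A. \<xi> j \<omega>) (PiM A (\<lambda>_. Z))"

lemma space_history [simp]: "space (history M Z \<xi> A) = space M"
  by (simp add: history_def)

lemma history_component:
  assumes "j \<in> A" "\<And>j. j \<in> A \<Longrightarrow> \<xi> j \<in> space M \<rightarrow> space Z"
  shows "\<xi> j \<in> measurable (history M Z \<xi> A) Z"
proof -
  have "(\<lambda>\<omega>. \<lambda>j\<in>A. \<xi> j \<omega>) \<in> measurable (history M Z \<xi> A) (PiM A (\<lambda>_. Z))"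
    unfolding history_def using assms(2) by (intro measurable_vimage_algebra1) (fastforce simp: space_PiM)
  from measurable_compose[OF this measurable_component_singleton[OF assms(1)]] show ?thesis
    using assms(1) by simp
qed

lemma history_mono:
  assumes W: "W \<in> measurable (history M Z \<xi> A) S" and "A \<subseteq> B"
    and \<xi>: "\<And>j. j \<in> B \<Longrightarrow> \<xi> j \<in> space M \<rightarrow> space Z"
  shows "W \<in> measurable (history M Z \<xi> B) S"
proof -
  have "(\<lambda>\<omega>. \<lambda>j\<in>A. \<xi> j \<omega>) \<in> measurable (history M Z \<xi> B) (PiM A (\<lambda>_. Z))"
    using assms(2) by (intro measurable_restrict history_component \<xi>) auto
  then have "(\<lambda>\<omega>. \<omega>) \<in> measurable (history M Z \<xi> B) (history M Z \<xi> A)"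
    unfolding history_def[of M Z \<xi> A] by (intro measurable_vimage_algebra2) auto
  from measurable_compose[OF this W] show ?thesis .
qed

context prob_space
begin

text \<open>Fubini, with independence given as a product law. The inner integral draws a fresh
  sample while \<open>X \<omega>\<close> is frozen, which plays the role of the conditional
  expectation.\<close>

lemma nn_integral_product_distr:
  assumes eq: "distr M S X \<Otimes>\<^sub>M distr M T Y = distr M (S \<Otimes>\<^sub>M T) (\<lambda>\<omega>. (X \<omega>, Y \<omega>))"
    and [measurable]: "X \<in> measurable M S" "Y \<in> measurable M T" "h \<in> borel_measurable (S \<Otimes>\<^sub>M T)"
  shows "(\<integral>\<^sup>+\<omega>. h (X \<omega>, Y \<omega>) \<partial>M) = (\<integral>\<^sup>+\<omega>. \<integral>\<^sup>+\<omega>'. h (X \<omega>, Y \<omega>') \<partial>M \<partial>M)"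
proof -
  interpret Y: prob_space "distr M T Y" by (rule prob_space_distr) simp
  have "(\<integral>\<^sup>+\<omega>. h (X \<omega>, Y \<omega>) \<partial>M) = (\<integral>\<^sup>+p. h p \<partial>(distr M S X \<Otimes>\<^sub>M distr M T Y))"
    unfolding eq by (subst nn_integral_distr) auto
  also have "\<dots> = (\<integral>\<^sup>+s. \<integral>\<^sup>+t. h (s, t) \<partial>distr M T Y \<partial>distr M S X)"
    by (rule Y.nn_integral_fst[symmetric]) simp
  also have "\<dots> = (\<integral>\<^sup>+\<omega>. \<integral>\<^sup>+t. h (X \<omega>, t) \<partial>distr M T Y \<partial>M)"
    by (rule nn_integral_distr) simp_all
  also have "\<dots> = (\<integral>\<^sup>+\<omega>. \<integral>\<^sup>+\<omega>'. h (X \<omega>, Y \<omega>') \<partial>M \<partial>M)"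
  proof (rule nn_integral_cong)
    fix \<omega> assume "\<omega> \<in> space M"
    then have [measurable]: "X \<omega> \<in> space S"
      using \<open>X \<in> measurable M S\<close> by (rule measurable_space[rotated])
    show "(\<integral>\<^sup>+t. h (X \<omega>, t) \<partial>distr M T Y) = (\<integral>\<^sup>+\<omega>'. h (X \<omega>, Y \<omega>') \<partial>M)"
      by (rule nn_integral_distr) simp_all
  qed
  finally show ?thesis .
qed

text \<open>The same exchange for signed or vector-valued integrands. Integrability is a premise
  here; for the sampled gradients it comes from the nonnegative version.\<close>

lemma integral_product_distr:
  fixes h :: "_ \<Rightarrow> 'c::{banach, second_countable_topology}"
  assumes eq: "distr M S X \<Otimes>\<^sub>M distr M T Y = distr M (S \<Otimes>\<^sub>M T) (\<lambda>\<omega>. (X \<omega>, Y \<omega>))"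
    and [measurable]: "X \<in> measurable M S" "Y \<in> measurable M T" "h \<in> borel_measurable (S \<Otimes>\<^sub>M T)"
    and int: "integrable M (\<lambda>\<omega>. h (X \<omega>, Y \<omega>))"
  shows "integrable M (\<lambda>\<omega>. \<integral>\<omega>'. h (X \<omega>, Y \<omega>') \<partial>M)"
    and "(\<integral>\<omega>. h (X \<omega>, Y \<omega>) \<partial>M) = (\<integral>\<omega>. \<integral>\<omega>'. h (X \<omega>, Y \<omega>') \<partial>M \<partial>M)"
proof -
  interpret X: prob_space "distr M S X" by (rule prob_space_distr) simp
  interpret Y: prob_space "distr M T Y" by (rule prob_space_distr) simp
  interpret XY: pair_prob_space "distr M S X" "distr M T Y" ..
  have int': "integrable (distr M S X \<Otimes>\<^sub>M distr M T Y) h"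
    unfolding eq using int by (subst integrable_distr_eq) auto
  have inner: "(\<integral>t. h (X \<omega>, t) \<partial>distr M T Y) = (\<integral>\<omega>'. h (X \<omega>, Y \<omega>') \<partial>M)" if "\<omega> \<in> space M" for \<omega>
  proof -
    have [measurable]: "X \<omega> \<in> space S"
      using that \<open>X \<in> measurable M S\<close> by (rule measurable_space[rotated])
    show ?thesis by (rule integral_distr) simp_all
  qed
  have meas: "(\<lambda>s. \<integral>t. h (s, t) \<partial>distr M T Y) \<in> borel_measurable S"
    by (rule Y.borel_measurable_lebesgue_integral) simp
  have "integrable (distr M S X) (\<lambda>s. \<integral>t. h (s, t) \<partial>distr M T Y)"
    by (rule XY.integrable_fst'[OF int'])
  then have "integrable M (\<lambda>\<omega>. \<integral>t. h (X \<omega>, t) \<partial>distr M T Y)"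
    by (subst (asm) integrable_distr_eq) (auto intro: meas)
  then show "integrable M (\<lambda>\<omega>. \<integral>\<omega>'. h (X \<omega>, Y \<omega>') \<partial>M)"
    by (subst (asm) Bochner_Integration.integrable_cong[OF refl inner])
  have "(\<integral>\<omega>. h (X \<omega>, Y \<omega>) \<partial>M) = (\<integral>p. h p \<partial>(distr M S X \<Otimes>\<^sub>M distr M T Y))"
    unfolding eq by (subst integral_distr) auto
  also have "\<dots> = (\<integral>s. \<integral>t. h (s, t) \<partial>distr M T Y \<partial>distr M S X)"
    by (rule XY.integral_fst'[OF int', symmetric])
  also have "\<dots> = (\<integral>\<omega>. \<integral>t. h (X \<omega>, t) \<partial>distr M T Y \<partial>M)"
    by (rule integral_distr) (simp_all add: meas)
  also have "\<dots> = (\<integral>\<omega>. \<integral>\<omega>'. h (X \<omega>, Y \<omega>') \<partial>M \<partial>M)"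
    by (rule Bochner_Integration.integral_cong) (auto simp: inner)
  finally show "(\<integral>\<omega>. h (X \<omega>, Y \<omega>) \<partial>M) = (\<integral>\<omega>. \<integral>\<omega>'. h (X \<omega>, Y \<omega>') \<partial>M \<partial>M)" .
qed

lemma measurable_history:
  assumes "indep_vars (\<lambda>_. Z) \<xi> I" "A \<subseteq> I"
    and W: "W \<in> measurable (history M Z \<xi> A) S"
  shows "W \<in> measurable M S"
proof -
  have "(\<lambda>\<omega>. \<lambda>j\<in>A. \<xi> j \<omega>) \<in> measurable M (PiM A (\<lambda>_. Z))"
    using assms(1,2) by (intro measurable_restrict) (auto simp: indep_vars_def)
  then have "sets (history M Z \<xi> A) \<subseteq> events"
    unfolding history_def by (subst sets_vimage_algebra2) (auto intro: measurable_sets dest: measurable_space)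
  with W show ?thesis
    by (auto simp: measurable_def)
qed

text \<open>Events of \<open>W\<close> are preimages under the block of samples indexed by
  \<open>A\<close>, and this block is independent of \<open>\<xi> i\<close> because \<open>i\<close>
  lies outside \<open>A\<close>. Hence both laws agree on rectangles.\<close>

lemma product_distr_history:
  assumes indep: "indep_vars (\<lambda>_. Z) \<xi> I" and A: "A \<subseteq> I" "i \<in> I" "i \<notin> A"
    and W: "W \<in> measurable (history M Z \<xi> A) S"
  shows "distr M S W \<Otimes>\<^sub>M distr M Z (\<xi> i) = distr M (S \<Otimes>\<^sub>M Z) (\<lambda>\<omega>. (W \<omega>, \<xi> i \<omega>))"
proof -
  let ?\<Xi> = "\<lambda>\<omega>. \<lambda>j\<in>A. \<xi> j \<omega>" and ?\<xi> = "\<lambda>\<omega>. \<lambda>j\<in>{i}. \<xi> j \<omega>"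
  have ind: "indep_var (PiM A (\<lambda>_. Z)) ?\<Xi> (PiM {i} (\<lambda>_. Z)) ?\<xi>"
    using A by (intro indep_var_restrict[OF indep]) auto
  note rv = indep_var_rv1[OF ind] indep_var_rv2[OF ind]
  have [measurable]: "\<xi> i \<in> measurable M Z"
    using indep A by (auto simp: indep_vars_def)
  have [measurable]: "W \<in> measurable M S"
    by (rule measurable_history[OF indep A(1) W])
  interpret W: prob_space "distr M S W" by (rule prob_space_distr) simp
  interpret \<xi>: prob_space "distr M Z (\<xi> i)" by (rule prob_space_distr) simp
  show ?thesis
  proof (rule pair_measure_eqI)
    show "sigma_finite_measure (distr M S W)" "sigma_finite_measure (distr M Z (\<xi> i))" by unfold_locales
    show "sets (distr M S W \<Otimes>\<^sub>M distr M Z (\<xi> i)) = sets (distr M (S \<Otimes>\<^sub>M Z) (\<lambda>\<omega>. (W \<omega>, \<xi> i \<omega>)))"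
      by (simp cong: sets_pair_measure_cong)
    fix B C assume "B \<in> sets (distr M S W)" "C \<in> sets (distr M Z (\<xi> i))"
    then have [measurable]: "B \<in> sets S" "C \<in> sets Z" by simp_all
    have "W -` B \<inter> space M \<in> sets (history M Z \<xi> A)"
      using measurable_sets[OF W, of B] by simp
    then obtain B' where B': "B' \<in> sets (PiM A (\<lambda>_. Z))" "W -` B \<inter> space M = ?\<Xi> -` B' \<inter> space M"
      using rv(1) unfolding history_def by (subst (asm) sets_vimage_algebra2) (auto dest: measurable_space)
    \<comment> \<open>The block over \<open>{i}\<close> takes values in a one-factor product, so
      \<open>C\<close> is transported there to match the form in which independence is
      available.\<close>
    let ?C' = "(\<lambda>w. w i) -` C \<inter> space (PiM {i} (\<lambda>_. Z))"
    have C': "?C' \<in> sets (PiM {i} (\<lambda>_. Z))"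
      by measurable
    have C'_eq: "\<xi> i -` C \<inter> space M = ?\<xi> -` ?C' \<inter> space M"
      using measurable_space[OF rv(2)] by auto
    have "emeasure (distr M (S \<Otimes>\<^sub>M Z) (\<lambda>\<omega>. (W \<omega>, \<xi> i \<omega>))) (B \<times> C)
        = prob ((W -` B \<inter> space M) \<inter> (\<xi> i -` C \<inter> space M))"
      by (subst emeasure_distr) (auto simp: emeasure_eq_measure intro!: arg_cong[where f = prob])
    also have "\<dots> = prob (W -` B \<inter> space M) * prob (\<xi> i -` C \<inter> space M)"
      using indep_varD[OF ind B'(1) C'] unfolding B'(2) C'_eq
      by (simp add: vimage_def Int_def conj_ac)
    finally show "emeasure (distr M S W) B * emeasure (distr M Z (\<xi> i)) C
        = emeasure (distr M (S \<Otimes>\<^sub>M Z) (\<lambda>\<omega>. (W \<omega>, \<xi> i \<omega>))) (B \<times> C)"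
      by (simp add: emeasure_distr emeasure_eq_measure ennreal_mult)
  qed
qed

end

section \<open>One outer iteration\<close>

text \<open>The two inner loops of one iteration are merged into a single pass of \<open>N\<close>
  steps, with estimator and gradient depending on the step. Independence is required of the pair of
  \<open>x\<close> and \<open>u k\<close>, since the gradient sampled at \<open>u k\<close> is later
  paired with \<open>x - z\<close>. The summand
  \<open>\<rho> * norm (u k \<omega> - x \<omega>)\<close> accounts for points outside the feasible
  set, and \<open>small_step\<close> limits the growth it causes.\<close>

locale sgd_pass = prob_space P for P :: "'w measure" +
  fixes Z :: "'z measure"
    and x :: "'w \<Rightarrow> 'a::euclidean_space" and u :: "nat \<Rightarrow> 'w \<Rightarrow> 'a"
    and \<xi> :: "nat \<Rightarrow> 'w \<Rightarrow> 'z"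
    and g :: "nat \<Rightarrow> 'a \<Rightarrow> 'z \<Rightarrow> 'a" and d :: "nat \<Rightarrow> 'a \<Rightarrow> 'a"
    and z :: 'a and N :: nat and \<alpha> \<Gamma> \<rho> L \<Theta> m :: real
  assumes indep: "\<And>k. k < N \<Longrightarrow> distr P (borel \<Otimes>\<^sub>M borel) (\<lambda>\<omega>. (x \<omega>, u k \<omega>)) \<Otimes>\<^sub>M distr P Z (\<xi> k)
      = distr P ((borel \<Otimes>\<^sub>M borel) \<Otimes>\<^sub>M Z) (\<lambda>\<omega>. ((x \<omega>, u k \<omega>), \<xi> k \<omega>))"
    and xi_meas: "\<And>k. k < N \<Longrightarrow> \<xi> k \<in> measurable P Z"
    and x_meas [measurable]: "x \<in> borel_measurable P"
    and g_meas [measurable]: "\<And>k. (\<lambda>(v, s). g k v s) \<in> borel_measurable (borel \<Otimes>\<^sub>M Z)"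
    and d_meas [measurable]: "\<And>k. d k \<in> borel_measurable borel"
    and u_0: "\<And>\<omega>. \<omega> \<in> space P \<Longrightarrow> u 0 \<omega> = x \<omega>"
    and u_Suc: "\<And>k \<omega>. k < N \<Longrightarrow> \<omega> \<in> space P \<Longrightarrow>
      u (Suc k) \<omega> = u k \<omega> - \<alpha> *\<^sub>R g k (u k \<omega>) (\<xi> k \<omega>)"
    and unbiased: "\<And>k. k < N \<Longrightarrow> AE \<omega> in P. integrable P (\<lambda>\<omega>'. g k (u k \<omega>) (\<xi> k \<omega>')) \<and>
      (\<integral>\<omega>'. g k (u k \<omega>) (\<xi> k \<omega>') \<partial>P) = d k (u k \<omega>)"
    and second_moment: "\<And>k. k < N \<Longrightarrow> AE \<omega> in P.
      integrable P (\<lambda>\<omega>'. (norm (g k (u k \<omega>) (\<xi> k \<omega>')))\<^sup>2) \<and>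
      (\<integral>\<omega>'. (norm (g k (u k \<omega>) (\<xi> k \<omega>')))\<^sup>2 \<partial>P) \<le> (\<Gamma> + \<rho> * norm (u k \<omega> - x \<omega>))\<^sup>2"
    and lipschitz_at: "\<And>k. k < N \<Longrightarrow> AE \<omega> in P.
      norm (d k (u k \<omega>) - d k (x \<omega>)) \<le> L * norm (u k \<omega> - x \<omega>)"
    and x_bounded: "\<And>\<omega>. \<omega> \<in> space P \<Longrightarrow> norm (x \<omega> - z) \<le> \<Theta>"
    and d_bounded: "\<And>k \<omega>. \<omega> \<in> space P \<Longrightarrow> norm (d k (x \<omega>)) \<le> m"
    and nonneg: "\<alpha> \<ge> 0" "\<Gamma> \<ge> 0" "\<rho> \<ge> 0" "L \<ge> 0" "\<Theta> \<ge> 0"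
    and small_step: "\<alpha> * \<rho> * real N \<le> 1 / 2"
begin

text \<open>
  A majorant for the solution of the recursion \<open>V (k + 1) = (1 + \<alpha> \<rho>) V k + \<alpha> \<Gamma>\<close>, \<open>V 0 = 0\<close>,
  that the root mean square displacements obey, valid while \<open>\<alpha> \<rho> k \<le> 1 / 2\<close>.
\<close>

definition drift :: "nat \<Rightarrow> real" where
  "drift k = \<alpha> * \<Gamma> * (real k + 2 / 3 * (\<alpha> * \<rho>) * (real k)\<^sup>2)"

lemma drift_nonneg: "drift k \<ge> 0"
  using nonneg by (simp add: drift_def)

text \<open>With \<open>h = \<alpha> * \<rho>\<close>, the exact solution has second-order
  coefficient \<open>h / 2\<close>. Raising it to \<open>2 / 3 * h\<close> yields an excess of
  \<open>h * k / 3\<close>, which pays for the remainder \<open>2 / 3 * (h * k)\<^sup>2\<close>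
  because \<open>h * k \<le> 1 / 2\<close>.\<close>

lemma drift_Suc:
  assumes "k < N"
  shows "drift k + \<alpha> * (\<Gamma> + \<rho> * drift k) \<le> drift (Suc k)"
proof -
  define h where "h = \<alpha> * \<rho>"
  have h: "h \<ge> 0" using nonneg by (simp add: h_def)
  have "h * real k \<le> h * real N"
    using assms h by (intro mult_left_mono) auto
  then have hk: "h * real k \<le> 1 / 2"
    using small_step by (simp add: h_def)
  have "(h * real k) * (h * real k) \<le> (1 / 2) * (h * real k)"
    using hk h by (intro mult_right_mono) auto
  moreover have "(1 + h) * (real k + 2 / 3 * h * (real k)\<^sup>2) + 1 = 1 + real k + h * real k
      + 2 / 3 * (h * (real k)\<^sup>2) + 2 / 3 * ((h * real k) * (h * real k))"
    by (simp add: power2_eq_square algebra_simps)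
  moreover have "real (Suc k) + 2 / 3 * h * (real (Suc k))\<^sup>2 = 1 + real k + 4 / 3 * (h * real k)
      + 2 / 3 * (h * (real k)\<^sup>2) + 2 / 3 * h"
    by (simp add: power2_eq_square algebra_simps)
  ultimately have "(1 + h) * (real k + 2 / 3 * h * (real k)\<^sup>2) + 1
      \<le> real (Suc k) + 2 / 3 * h * (real (Suc k))\<^sup>2"
    using h by linarith
  then have "\<alpha> * \<Gamma> * ((1 + h) * (real k + 2 / 3 * h * (real k)\<^sup>2) + 1) \<le> drift (Suc k)"
    unfolding drift_def h_def[symmetric] using nonneg by (intro mult_left_mono) auto
  moreover have "drift k + \<alpha> * (\<Gamma> + \<rho> * drift k) = (1 + h) * drift k + \<alpha> * \<Gamma>"
    by (simp add: h_def algebra_simps)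
  moreover have "\<dots> = \<alpha> * \<Gamma> * ((1 + h) * (real k + 2 / 3 * h * (real k)\<^sup>2) + 1)"
    unfolding drift_def h_def[symmetric] by (simp only: distrib_left mult_1_right ac_simps)
  ultimately show ?thesis by linarith
qed

text \<open>Within a pass the quadratic correction is at most 2/3 * 1/2 = 1/3 of the linear
  term.\<close>

lemma drift_le:
  assumes "k \<le> N"
  shows "drift k \<le> 4 / 3 * (\<alpha> * \<Gamma> * real k)"
proof -
  have "\<alpha> * \<rho> * real k \<le> \<alpha> * \<rho> * real N"
    using assms nonneg by (intro mult_left_mono) auto
  then have "\<alpha> * \<Gamma> * real k * (1 + 2 / 3 * (\<alpha> * \<rho> * real k)) \<le> \<alpha> * \<Gamma> * real k * (4 / 3)"
    using small_step nonneg by (intro mult_left_mono) auto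
  then show ?thesis
    by (simp add: drift_def power2_eq_square algebra_simps)
qed

section \<open>Moments of the sampled gradients and of the displacements\<close>

lemma gradient_meas:
  assumes "k < N" "u k \<in> borel_measurable P"
  shows "(\<lambda>\<omega>. g k (u k \<omega>) (\<xi> k \<omega>)) \<in> borel_measurable P"
proof -
  note [measurable] = xi_meas[OF assms(1)] assms(2)
  have "(\<lambda>\<omega>. (\<lambda>(v, s). g k v s) (u k \<omega>, \<xi> k \<omega>)) \<in> borel_measurable P"
    by measurable
  then show ?thesis by simp
qed

lemma u_meas: "k \<le> N \<Longrightarrow> u k \<in> borel_measurable P"
proof (induction k)
  case 0
  show ?case
    using measurable_cong[of P "u 0" x borel] u_0 by simp
next
  case (Suc k)
  then have k: "k < N" and [measurable]: "u k \<in> borel_measurable P" by auto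
  note [measurable] = gradient_meas[OF k \<open>u k \<in> borel_measurable P\<close>]
  have "(\<lambda>\<omega>. u k \<omega> - \<alpha> *\<^sub>R g k (u k \<omega>) (\<xi> k \<omega>)) \<in> borel_measurable P"
    by measurable
  then show ?case
    using measurable_cong[of P "u (Suc k)" "\<lambda>\<omega>. u k \<omega> - \<alpha> *\<^sub>R g k (u k \<omega>) (\<xi> k \<omega>)" borel]
      u_Suc[OF k] by simp
qed

text \<open>Averaging over the fresh sample bounds the second moment by \<open>(\<Gamma> + \<rho> *
  norm (u k \<omega> - x \<omega>))\<^sup>2\<close>, and Minkowski turns this into a bound through
  \<open>drift k\<close>. The computation uses nonnegative integrals because integrability is part
  of the conclusion.\<close>

lemma gradient_square:
  assumes k: "k < N"
    and int: "integrable P (\<lambda>\<omega>. (norm (u k \<omega> - x \<omega>))\<^sup>2)"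
    and le: "(\<integral>\<omega>. (norm (u k \<omega> - x \<omega>))\<^sup>2 \<partial>P) \<le> (drift k)\<^sup>2"
  shows "integrable P (\<lambda>\<omega>. (norm (g k (u k \<omega>) (\<xi> k \<omega>)))\<^sup>2)"
    and "(\<integral>\<omega>. (norm (g k (u k \<omega>) (\<xi> k \<omega>)))\<^sup>2 \<partial>P) \<le> (\<Gamma> + \<rho> * drift k)\<^sup>2"
proof -
  have [measurable]: "u k \<in> borel_measurable P" using u_meas k by simp
  note [measurable] = xi_meas[OF k] gradient_meas[OF k \<open>u k \<in> borel_measurable P\<close>]
  have "(\<lambda>\<omega>. (\<rho> * norm (u k \<omega> - x \<omega>))\<^sup>2) = (\<lambda>\<omega>. \<rho>\<^sup>2 * (norm (u k \<omega> - x \<omega>))\<^sup>2)"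
    by (simp add: power_mult_distrib)
  then have "integrable P (\<lambda>\<omega>. (\<rho> * norm (u k \<omega> - x \<omega>))\<^sup>2)"
    "(\<integral>\<omega>. (\<rho> * norm (u k \<omega> - x \<omega>))\<^sup>2 \<partial>P) \<le> (\<rho> * drift k)\<^sup>2"
    using int le by (simp_all add: power_mult_distrib mult_left_mono)
  then have int2: "integrable P (\<lambda>\<omega>. (\<Gamma> + \<rho> * norm (u k \<omega> - x \<omega>))\<^sup>2)"
    and le2: "(\<integral>\<omega>. (\<Gamma> + \<rho> * norm (u k \<omega> - x \<omega>))\<^sup>2 \<partial>P) \<le> (\<Gamma> + \<rho> * drift k)\<^sup>2"
    using Minkowski_integral_power2[of "\<lambda>_. \<Gamma>" P "\<lambda>\<omega>. \<rho> * norm (u k \<omega> - x \<omega>)" \<Gamma> "\<rho> * drift k"]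
      nonneg drift_nonneg[of k] by (simp_all add: prob_space)
  \<comment> \<open>A function of the nested triple, to match the product law in
    \<open>indep\<close>.\<close>
  define h where "h = (\<lambda>p :: ('a \<times> 'a) \<times> 'z. ennreal ((norm (g k (snd (fst p)) (snd p)))\<^sup>2))"
  have h[measurable]: "h \<in> borel_measurable ((borel \<Otimes>\<^sub>M borel) \<Otimes>\<^sub>M Z)"
  proof -
    have "(\<lambda>p. (\<lambda>(v, s). g k v s) (snd (fst p), snd p)) \<in> borel_measurable ((borel \<Otimes>\<^sub>M borel) \<Otimes>\<^sub>M Z)"
      by measurable
    then have [measurable]: "(\<lambda>p. g k (snd (fst p)) (snd p)) \<in> borel_measurable ((borel \<Otimes>\<^sub>M borel) \<Otimes>\<^sub>M Z)"
      by simp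
    show ?thesis unfolding h_def by measurable
  qed
  have "(\<integral>\<^sup>+\<omega>. ennreal ((norm (g k (u k \<omega>) (\<xi> k \<omega>)))\<^sup>2) \<partial>P)
      = (\<integral>\<^sup>+\<omega>. \<integral>\<^sup>+\<omega>'. ennreal ((norm (g k (u k \<omega>) (\<xi> k \<omega>')))\<^sup>2) \<partial>P \<partial>P)"
    using nn_integral_product_distr[OF indep[OF k] _ _ h] by (simp add: h_def)
  also have "\<dots> \<le> (\<integral>\<^sup>+\<omega>. ennreal ((\<Gamma> + \<rho> * norm (u k \<omega> - x \<omega>))\<^sup>2) \<partial>P)"
  proof (rule nn_integral_mono_AE)
    show "AE \<omega> in P. (\<integral>\<^sup>+\<omega>'. ennreal ((norm (g k (u k \<omega>) (\<xi> k \<omega>')))\<^sup>2) \<partial>P)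
        \<le> ennreal ((\<Gamma> + \<rho> * norm (u k \<omega> - x \<omega>))\<^sup>2)"
      using second_moment[OF k]
      by eventually_elim (subst nn_integral_eq_integral, auto intro: ennreal_leI)
  qed
  also have "\<dots> = ennreal (\<integral>\<omega>. (\<Gamma> + \<rho> * norm (u k \<omega> - x \<omega>))\<^sup>2 \<partial>P)"
    by (rule nn_integral_eq_integral[OF int2]) simp
  also have "\<dots> \<le> ennreal ((\<Gamma> + \<rho> * drift k)\<^sup>2)"
    by (rule ennreal_leI[OF le2])
  finally have fin: "(\<integral>\<^sup>+\<omega>. ennreal ((norm (g k (u k \<omega>) (\<xi> k \<omega>)))\<^sup>2) \<partial>P)
      \<le> ennreal ((\<Gamma> + \<rho> * drift k)\<^sup>2)" .
  show i: "integrable P (\<lambda>\<omega>. (norm (g k (u k \<omega>) (\<xi> k \<omega>)))\<^sup>2)"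
    by (rule integrableI_nonneg) (use fin in \<open>auto intro: le_less_trans\<close>)
  have "ennreal (\<integral>\<omega>. (norm (g k (u k \<omega>) (\<xi> k \<omega>)))\<^sup>2 \<partial>P)
      = (\<integral>\<^sup>+\<omega>. ennreal ((norm (g k (u k \<omega>) (\<xi> k \<omega>)))\<^sup>2) \<partial>P)"
    by (rule nn_integral_eq_integral[OF i, symmetric]) simp
  then have "ennreal (\<integral>\<omega>. (norm (g k (u k \<omega>) (\<xi> k \<omega>)))\<^sup>2 \<partial>P) \<le> ennreal ((\<Gamma> + \<rho> * drift k)\<^sup>2)"
    using fin by (rule ord_eq_le_trans)
  then show "(\<integral>\<omega>. (norm (g k (u k \<omega>) (\<xi> k \<omega>)))\<^sup>2 \<partial>P) \<le> (\<Gamma> + \<rho> * drift k)\<^sup>2"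
    by (subst (asm) ennreal_le_iff) auto
qed

text \<open>By Minkowski the root mean square grows in one step by at most \<open>\<alpha>\<close>
  times that of the sampled gradient. The latter depends on the displacement reached so far, so the
  induction carries \<open>drift\<close> and closes with \<open>drift_Suc\<close>.\<close>

lemma displacement:
  assumes "k \<le> N"
  shows "integrable P (\<lambda>\<omega>. (norm (u k \<omega> - x \<omega>))\<^sup>2) \<and>
    (\<integral>\<omega>. (norm (u k \<omega> - x \<omega>))\<^sup>2 \<partial>P) \<le> (drift k)\<^sup>2"
  using assms
proof (induction k)
  case 0
  have "integrable P (\<lambda>\<omega>. (norm (u 0 \<omega> - x \<omega>))\<^sup>2) = integrable P (\<lambda>_. 0 :: real)"
    "(\<integral>\<omega>. (norm (u 0 \<omega> - x \<omega>))\<^sup>2 \<partial>P) = (\<integral>_. 0 \<partial>P)"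
    by (rule Bochner_Integration.integrable_cong Bochner_Integration.integral_cong; simp add: u_0)+
  then show ?case by simp
next
  case (Suc k)
  then have k: "k < N" and IH: "integrable P (\<lambda>\<omega>. (norm (u k \<omega> - x \<omega>))\<^sup>2)"
    "(\<integral>\<omega>. (norm (u k \<omega> - x \<omega>))\<^sup>2 \<partial>P) \<le> (drift k)\<^sup>2" by auto
  have [measurable]: "u k \<in> borel_measurable P" "u (Suc k) \<in> borel_measurable P"
    using u_meas k by simp_all
  note [measurable] = gradient_meas[OF k \<open>u k \<in> borel_measurable P\<close>]
  let ?a = "\<lambda>\<omega>. norm (u k \<omega> - x \<omega>)" and ?b = "\<lambda>\<omega>. \<alpha> * norm (g k (u k \<omega>) (\<xi> k \<omega>))"
  note gs = gradient_square[OF k IH]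
  have "(\<lambda>\<omega>. (?b \<omega>)\<^sup>2) = (\<lambda>\<omega>. \<alpha>\<^sup>2 * (norm (g k (u k \<omega>) (\<xi> k \<omega>)))\<^sup>2)"
    by (simp add: power_mult_distrib)
  then have b: "integrable P (\<lambda>\<omega>. (?b \<omega>)\<^sup>2)" "(\<integral>\<omega>. (?b \<omega>)\<^sup>2 \<partial>P) \<le> (\<alpha> * (\<Gamma> + \<rho> * drift k))\<^sup>2"
    using gs by (simp_all add: power_mult_distrib mult_left_mono)
  have sum: "integrable P (\<lambda>\<omega>. (?a \<omega> + ?b \<omega>)\<^sup>2)"
    "(\<integral>\<omega>. (?a \<omega> + ?b \<omega>)\<^sup>2 \<partial>P) \<le> (drift k + \<alpha> * (\<Gamma> + \<rho> * drift k))\<^sup>2"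
    using Minkowski_integral_power2[of ?a P ?b "drift k" "\<alpha> * (\<Gamma> + \<rho> * drift k)"]
      IH b nonneg drift_nonneg[of k] by simp_all
  have pt: "(norm (u (Suc k) \<omega> - x \<omega>))\<^sup>2 \<le> (?a \<omega> + ?b \<omega>)\<^sup>2" if "\<omega> \<in> space P" for \<omega>
  proof (rule power_mono)
    have "u (Suc k) \<omega> - x \<omega> = (u k \<omega> - x \<omega>) - \<alpha> *\<^sub>R g k (u k \<omega>) (\<xi> k \<omega>)"
      using u_Suc[OF k that] by (simp add: algebra_simps)
    then show "norm (u (Suc k) \<omega> - x \<omega>) \<le> ?a \<omega> + ?b \<omega>"
      using norm_triangle_ineq4[of "u k \<omega> - x \<omega>" "\<alpha> *\<^sub>R g k (u k \<omega>) (\<xi> k \<omega>)"] nonneg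
      by (simp only: norm_scaleR abs_of_nonneg)
  qed simp
  have i: "integrable P (\<lambda>\<omega>. (norm (u (Suc k) \<omega> - x \<omega>))\<^sup>2)"
    by (rule Bochner_Integration.integrable_bound[OF sum(1)]) (auto intro!: AE_I2 pt)
  moreover have "(\<integral>\<omega>. (norm (u (Suc k) \<omega> - x \<omega>))\<^sup>2 \<partial>P) \<le> (\<integral>\<omega>. (?a \<omega> + ?b \<omega>)\<^sup>2 \<partial>P)"
    by (rule integral_mono[OF i sum(1) pt])
  moreover have "(drift k + \<alpha> * (\<Gamma> + \<rho> * drift k))\<^sup>2 \<le> (drift (Suc k))\<^sup>2"
    using drift_Suc[OF k] nonneg drift_nonneg[of k] by (intro power_mono) auto
  ultimately show ?case using sum(2) by linarith
qed

lemma displacement_abs: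
  assumes "k \<le> N"
  shows "integrable P (\<lambda>\<omega>. norm (u k \<omega> - x \<omega>))" "(\<integral>\<omega>. norm (u k \<omega> - x \<omega>) \<partial>P) \<le> drift k"
proof -
  have [measurable]: "u k \<in> borel_measurable P" using u_meas assms by simp
  show "integrable P (\<lambda>\<omega>. norm (u k \<omega> - x \<omega>))" "(\<integral>\<omega>. norm (u k \<omega> - x \<omega>) \<partial>P) \<le> drift k"
    using Cauchy_Schwarz_integral[of "\<lambda>\<omega>. norm (u k \<omega> - x \<omega>)" P "\<lambda>_. 1" "drift k" 1]
      displacement[OF assms] drift_nonneg[of k] by (simp_all add: prob_space)
qed

text \<open>The new sample is averaged out first, with \<open>x\<close> and \<open>u k\<close>
  frozen, which replaces the estimator by \<open>d k (u k \<omega>)\<close>. Moving this gradient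
  back from \<open>u k\<close> to \<open>x\<close> costs at most \<open>L * \<Theta>\<close> times
  the displacement.\<close>

lemma gradient_inner:
  assumes k: "k < N"
  shows "integrable P (\<lambda>\<omega>. g k (u k \<omega>) (\<xi> k \<omega>) \<bullet> (x \<omega> - z))"
    and "integrable P (\<lambda>\<omega>. d k (x \<omega>) \<bullet> (x \<omega> - z))"
    and "(\<integral>\<omega>. g k (u k \<omega>) (\<xi> k \<omega>) \<bullet> (x \<omega> - z) \<partial>P)
      \<ge> (\<integral>\<omega>. d k (x \<omega>) \<bullet> (x \<omega> - z) \<partial>P) - L * \<Theta> * drift k"
proof -
  have [measurable]: "u k \<in> borel_measurable P" using u_meas k by simp
  note [measurable] = xi_meas[OF k] gradient_meas[OF k \<open>u k \<in> borel_measurable P\<close>]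
  have "integrable P (\<lambda>\<omega>. norm (g k (u k \<omega>) (\<xi> k \<omega>)))"
    using Cauchy_Schwarz_integral(1)[of "\<lambda>\<omega>. norm (g k (u k \<omega>) (\<xi> k \<omega>))" P "\<lambda>_. 1"
        "\<Gamma> + \<rho> * drift k" 1] gradient_square[OF k] displacement[of k] k nonneg drift_nonneg[of k]
    by (simp add: prob_space)
  then have "integrable P (\<lambda>\<omega>. norm (g k (u k \<omega>) (\<xi> k \<omega>)) * \<Theta>)" by simp
  then show ig: "integrable P (\<lambda>\<omega>. g k (u k \<omega>) (\<xi> k \<omega>) \<bullet> (x \<omega> - z))"
  proof (rule Bochner_Integration.integrable_bound)
    show "AE \<omega> in P. norm (g k (u k \<omega>) (\<xi> k \<omega>) \<bullet> (x \<omega> - z))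
        \<le> norm (norm (g k (u k \<omega>) (\<xi> k \<omega>)) * \<Theta>)"
    proof (rule AE_I2)
      fix \<omega> assume "\<omega> \<in> space P"
      have "\<bar>g k (u k \<omega>) (\<xi> k \<omega>) \<bullet> (x \<omega> - z)\<bar> \<le> norm (g k (u k \<omega>) (\<xi> k \<omega>)) * norm (x \<omega> - z)"
        by (rule Cauchy_Schwarz_ineq2)
      also have "\<dots> \<le> norm (g k (u k \<omega>) (\<xi> k \<omega>)) * \<Theta>"
        by (intro mult_left_mono x_bounded \<open>\<omega> \<in> space P\<close>) simp
      finally show "norm (g k (u k \<omega>) (\<xi> k \<omega>) \<bullet> (x \<omega> - z)) \<le> norm (norm (g k (u k \<omega>) (\<xi> k \<omega>)) * \<Theta>)"
        using nonneg by simp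
    qed
  qed simp
  show id: "integrable P (\<lambda>\<omega>. d k (x \<omega>) \<bullet> (x \<omega> - z))"
  proof (rule integrable_const_bound[where B = "m * \<Theta>"])
    show "AE \<omega> in P. norm (d k (x \<omega>) \<bullet> (x \<omega> - z)) \<le> m * \<Theta>"
    proof (rule AE_I2)
      fix \<omega> assume w: "\<omega> \<in> space P"
      have "\<bar>d k (x \<omega>) \<bullet> (x \<omega> - z)\<bar> \<le> norm (d k (x \<omega>)) * norm (x \<omega> - z)"
        by (rule Cauchy_Schwarz_ineq2)
      also have "\<dots> \<le> m * \<Theta>"
        using d_bounded[OF w, of k] x_bounded[OF w] by (intro mult_mono) (auto intro: order_trans[OF norm_ge_zero])
      finally show "norm (d k (x \<omega>) \<bullet> (x \<omega> - z)) \<le> m * \<Theta>" by simp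
    qed
  qed measurable
  define h where "h = (\<lambda>p :: ('a \<times> 'a) \<times> 'z. g k (snd (fst p)) (snd p) \<bullet> (fst (fst p) - z))"
  have h[measurable]: "h \<in> borel_measurable ((borel \<Otimes>\<^sub>M borel) \<Otimes>\<^sub>M Z)"
  proof -
    have "(\<lambda>p. (\<lambda>(v, s). g k v s) (snd (fst p), snd p)) \<in> borel_measurable ((borel \<Otimes>\<^sub>M borel) \<Otimes>\<^sub>M Z)"
      by measurable
    then have [measurable]: "(\<lambda>p. g k (snd (fst p)) (snd p)) \<in> borel_measurable ((borel \<Otimes>\<^sub>M borel) \<Otimes>\<^sub>M Z)"
      by simp
    show ?thesis unfolding h_def by measurable
  qed
  have ih: "integrable P (\<lambda>\<omega>. h ((x \<omega>, u k \<omega>), \<xi> k \<omega>))"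
    using ig by (simp add: h_def)
  note fub = integral_product_distr[OF indep[OF k] _ _ h ih]
  have ae: "AE \<omega> in P. (\<integral>\<omega>'. h ((x \<omega>, u k \<omega>), \<xi> k \<omega>') \<partial>P) = d k (u k \<omega>) \<bullet> (x \<omega> - z)"
    using unbiased[OF k] by eventually_elim (auto simp: h_def)
  have lower: "AE \<omega> in P. (\<integral>\<omega>'. h ((x \<omega>, u k \<omega>), \<xi> k \<omega>') \<partial>P)
      \<ge> d k (x \<omega>) \<bullet> (x \<omega> - z) - L * \<Theta> * norm (u k \<omega> - x \<omega>)"
    using ae lipschitz_at[OF k] AE_space
  proof eventually_elim
    case (elim \<omega>)
    have "\<bar>(d k (u k \<omega>) - d k (x \<omega>)) \<bullet> (x \<omega> - z)\<bar> \<le> norm (d k (u k \<omega>) - d k (x \<omega>)) * norm (x \<omega> - z)"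
      by (rule Cauchy_Schwarz_ineq2)
    also have "\<dots> \<le> (L * norm (u k \<omega> - x \<omega>)) * \<Theta>"
      using elim x_bounded nonneg by (intro mult_mono) auto
    finally show ?case
      using elim(1) by (simp add: inner_diff_left algebra_simps abs_le_iff)
  qed
  have "(\<integral>\<omega>. d k (x \<omega>) \<bullet> (x \<omega> - z) \<partial>P) - L * \<Theta> * drift k
      \<le> (\<integral>\<omega>. d k (x \<omega>) \<bullet> (x \<omega> - z) \<partial>P) - L * \<Theta> * (\<integral>\<omega>. norm (u k \<omega> - x \<omega>) \<partial>P)"
    using displacement_abs[of k] k nonneg by (intro diff_left_mono mult_left_mono) auto
  also have "\<dots> = (\<integral>\<omega>. d k (x \<omega>) \<bullet> (x \<omega> - z) - L * \<Theta> * norm (u k \<omega> - x \<omega>) \<partial>P)"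
    using id displacement_abs[of k] k by simp
  also have "\<dots> \<le> (\<integral>\<omega>. \<integral>\<omega>'. h ((x \<omega>, u k \<omega>), \<xi> k \<omega>') \<partial>P \<partial>P)"
    using id displacement_abs[of k] k fub(1) lower by (intro integral_mono_AE) auto
  also have "\<dots> = (\<integral>\<omega>. g k (u k \<omega>) (\<xi> k \<omega>) \<bullet> (x \<omega> - z) \<partial>P)"
    using fub(2) by (simp add: h_def)
  finally show "(\<integral>\<omega>. g k (u k \<omega>) (\<xi> k \<omega>) \<bullet> (x \<omega> - z) \<partial>P)
      \<ge> (\<integral>\<omega>. d k (x \<omega>) \<bullet> (x \<omega> - z) \<partial>P) - L * \<Theta> * drift k" .
qed

text \<open>The square is expanded once, around the start \<open>x\<close> of the pass, and not step
  by step. The inner products with the sampled gradients then give the gradient sum at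
  \<open>x\<close> up to drift errors, and the squared total displacement averages to at most
  \<open>(drift N)\<^sup>2\<close>.\<close>

lemma pass_bound:
  shows "integrable P (\<lambda>\<omega>. (norm (u N \<omega> - z))\<^sup>2)"
    and "(\<integral>\<omega>. (norm (u N \<omega> - z))\<^sup>2 \<partial>P)
      \<le> (\<integral>\<omega>. (norm (x \<omega> - z))\<^sup>2 \<partial>P) - 2 * \<alpha> * (\<integral>\<omega>. (\<Sum>k<N. d k (x \<omega>)) \<bullet> (x \<omega> - z) \<partial>P)
        + 2 * (\<alpha> * real N)\<^sup>2 * (\<Gamma>\<^sup>2 + L * \<Theta> * \<Gamma>)"
proof -
  let ?G = "\<lambda>k \<omega>. g k (u k \<omega>) (\<xi> k \<omega>)"
  have sum: "u k \<omega> - x \<omega> = - (\<alpha> *\<^sub>R (\<Sum>j<k. ?G j \<omega>))" if "k \<le> N" "\<omega> \<in> space P" for k \<omega>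
    using that
  proof (induction k)
    case 0
    then show ?case by (simp add: u_0)
  next
    case (Suc k)
    then have "u k \<omega> - x \<omega> = - (\<alpha> *\<^sub>R (\<Sum>j<k. ?G j \<omega>))" by simp
    then show ?case
      using Suc.prems by (simp add: u_Suc scaleR_add_right algebra_simps)
  qed
  have eq: "(norm (u N \<omega> - z))\<^sup>2 = (norm (x \<omega> - z))\<^sup>2
      - 2 * \<alpha> * (\<Sum>k<N. ?G k \<omega> \<bullet> (x \<omega> - z)) + (norm (u N \<omega> - x \<omega>))\<^sup>2"
    if "\<omega> \<in> space P" for \<omega>
  proof -
    have "(norm (u N \<omega> - z))\<^sup>2 = (norm ((x \<omega> - z) + (u N \<omega> - x \<omega>)))\<^sup>2"
      by simp
    also have "\<dots> = (norm (x \<omega> - z))\<^sup>2 + 2 * ((u N \<omega> - x \<omega>) \<bullet> (x \<omega> - z)) + (norm (u N \<omega> - x \<omega>))\<^sup>2"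
      unfolding power2_norm_eq_inner inner_add_left inner_add_right by (simp add: inner_commute)
    also have "(u N \<omega> - x \<omega>) \<bullet> (x \<omega> - z) = - \<alpha> * (\<Sum>k<N. ?G k \<omega> \<bullet> (x \<omega> - z))"
      using sum[OF _ that, of N] by (simp add: inner_sum_left)
    finally show ?thesis by simp
  qed
  have ix: "integrable P (\<lambda>\<omega>. (norm (x \<omega> - z))\<^sup>2)"
    by (rule integrable_const_bound[where B = "\<Theta>\<^sup>2"])
      (auto intro!: AE_I2 power_mono x_bounded)
  have iu: "integrable P (\<lambda>\<omega>. (norm (u N \<omega> - x \<omega>))\<^sup>2)" and lu: "(\<integral>\<omega>. (norm (u N \<omega> - x \<omega>))\<^sup>2 \<partial>P) \<le> (drift N)\<^sup>2"
    using displacement[of N] by auto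
  have iG: "integrable P (\<lambda>\<omega>. (\<Sum>k<N. ?G k \<omega> \<bullet> (x \<omega> - z)))"
    using gradient_inner(1) by (intro Bochner_Integration.integrable_sum) simp
  let ?R = "\<lambda>\<omega>. (norm (x \<omega> - z))\<^sup>2
      - 2 * \<alpha> * (\<Sum>k<N. ?G k \<omega> \<bullet> (x \<omega> - z)) + (norm (u N \<omega> - x \<omega>))\<^sup>2"
  have "integrable P ?R" using ix iu iG by simp
  then show "integrable P (\<lambda>\<omega>. (norm (u N \<omega> - z))\<^sup>2)"
    by (subst Bochner_Integration.integrable_cong[OF refl eq])
  have "(\<integral>\<omega>. (norm (u N \<omega> - z))\<^sup>2 \<partial>P) = (\<integral>\<omega>. ?R \<omega> \<partial>P)"
    by (rule Bochner_Integration.integral_cong[OF refl eq])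
  also have "\<dots> = (\<integral>\<omega>. (norm (x \<omega> - z))\<^sup>2 \<partial>P) - 2 * \<alpha> * (\<Sum>k<N. \<integral>\<omega>. ?G k \<omega> \<bullet> (x \<omega> - z) \<partial>P)
      + (\<integral>\<omega>. (norm (u N \<omega> - x \<omega>))\<^sup>2 \<partial>P)"
    using ix iu iG gradient_inner(1) by (simp add: Bochner_Integration.integral_sum)
  also have "\<dots> \<le> (\<integral>\<omega>. (norm (x \<omega> - z))\<^sup>2 \<partial>P)
      - 2 * \<alpha> * (\<Sum>k<N. (\<integral>\<omega>. d k (x \<omega>) \<bullet> (x \<omega> - z) \<partial>P) - L * \<Theta> * drift k) + (drift N)\<^sup>2"
    using lu gradient_inner(3) nonneg by (intro add_mono diff_left_mono mult_left_mono sum_mono) auto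
  also have "(\<Sum>k<N. (\<integral>\<omega>. d k (x \<omega>) \<bullet> (x \<omega> - z) \<partial>P) - L * \<Theta> * drift k)
      = (\<integral>\<omega>. (\<Sum>k<N. d k (x \<omega>)) \<bullet> (x \<omega> - z) \<partial>P) - L * \<Theta> * (\<Sum>k<N. drift k)"
    using gradient_inner(2)
    by (simp add: inner_sum_left sum_subtractf sum_distrib_left Bochner_Integration.integral_sum)
  finally have 1: "(\<integral>\<omega>. (norm (u N \<omega> - z))\<^sup>2 \<partial>P)
      \<le> (\<integral>\<omega>. (norm (x \<omega> - z))\<^sup>2 \<partial>P) - 2 * \<alpha> * (\<integral>\<omega>. (\<Sum>k<N. d k (x \<omega>)) \<bullet> (x \<omega> - z) \<partial>P)
        + (2 * \<alpha> * L * \<Theta> * (\<Sum>k<N. drift k) + (drift N)\<^sup>2)"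
    by (simp add: algebra_simps)
  \<comment> \<open>The factor 2 of the conclusion covers both errors: the drift sum has coefficient
    4/3 * 1/2 \<le> 1, doubled by the cross term, and the squared displacement has coefficient 16/9
    \<le> 2.\<close>
  have "(\<Sum>k<N. drift k) \<le> (\<Sum>k<N. 4 / 3 * (\<alpha> * \<Gamma> * real k))"
    by (intro sum_mono drift_le) simp
  also have "\<dots> = 4 / 3 * (\<alpha> * \<Gamma>) * (\<Sum>k<N. real k)"
    by (simp add: sum_distrib_left mult.assoc)
  also have "\<dots> \<le> 4 / 3 * (\<alpha> * \<Gamma>) * ((real N)\<^sup>2 / 2)"
  proof (intro mult_left_mono)
    show "(\<Sum>k<N. real k) \<le> (real N)\<^sup>2 / 2"
      by (induction N) (auto simp: power2_eq_square field_simps)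
  qed (use nonneg in auto)
  also have "\<dots> \<le> \<alpha> * \<Gamma> * (real N)\<^sup>2"
    using nonneg by simp
  finally have "2 * \<alpha> * L * \<Theta> * (\<Sum>k<N. drift k) \<le> 2 * \<alpha> * L * \<Theta> * (\<alpha> * \<Gamma> * (real N)\<^sup>2)"
    using nonneg by (intro mult_left_mono) auto
  moreover have "(drift N)\<^sup>2 \<le> (4 / 3 * (\<alpha> * \<Gamma> * real N))\<^sup>2"
    using drift_le[of N] drift_nonneg by (intro power_mono) auto
  then have "(drift N)\<^sup>2 \<le> 2 * (\<alpha> * real N)\<^sup>2 * \<Gamma>\<^sup>2"
  proof (rule order_trans)
    have "(4 / 3 * (\<alpha> * \<Gamma> * real N))\<^sup>2 = 16 / 9 * ((\<alpha> * real N)\<^sup>2 * \<Gamma>\<^sup>2)"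
      by (simp add: power_mult_distrib power2_eq_square)
    moreover have "0 \<le> (\<alpha> * real N)\<^sup>2 * \<Gamma>\<^sup>2" by simp
    ultimately show "(4 / 3 * (\<alpha> * \<Gamma> * real N))\<^sup>2 \<le> 2 * (\<alpha> * real N)\<^sup>2 * \<Gamma>\<^sup>2"
      unfolding mult.assoc by linarith
  qed
  moreover have "2 * \<alpha> * L * \<Theta> * (\<alpha> * \<Gamma> * (real N)\<^sup>2) + 2 * (\<alpha> * real N)\<^sup>2 * \<Gamma>\<^sup>2
      = 2 * (\<alpha> * real N)\<^sup>2 * (\<Gamma>\<^sup>2 + L * \<Theta> * \<Gamma>)"
    by (simp add: power2_eq_square algebra_simps)
  ultimately have "2 * \<alpha> * L * \<Theta> * (\<Sum>k<N. drift k) + (drift N)\<^sup>2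
      \<le> 2 * (\<alpha> * real N)\<^sup>2 * (\<Gamma>\<^sup>2 + L * \<Theta> * \<Gamma>)"
    by linarith
  with 1 show "(\<integral>\<omega>. (norm (u N \<omega> - z))\<^sup>2 \<partial>P)
      \<le> (\<integral>\<omega>. (norm (x \<omega> - z))\<^sup>2 \<partial>P) - 2 * \<alpha> * (\<integral>\<omega>. (\<Sum>k<N. d k (x \<omega>)) \<bullet> (x \<omega> - z) \<partial>P)
        + 2 * (\<alpha> * real N)\<^sup>2 * (\<Gamma>\<^sup>2 + L * \<Theta> * \<Gamma>)"
    by linarith
qed

end

section \<open>Averaging over the iterations\<close>

text \<open>Multiplying the recursion at \<open>t\<close> by \<open>c * t * (t + 1) / 4\<close>
  leaves \<open>D t\<close> with coefficient \<open>c * t * (t - 1) / 4\<close>, so the distances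
  telescope and \<open>e t\<close> receives weight \<open>t\<close>. Up to \<open>t0\<close>,
  control comes from \<open>upper\<close> alone.\<close>

lemma weighted_average_bound:
  fixes e D \<beta> :: "nat \<Rightarrow> real"
  assumes c: "c > 0" and B: "B \<ge> 0" and D: "\<And>t. D t \<ge> 0"
    and \<beta>: "\<And>t. \<beta> t = 2 / (c * (real t + 1))"
    and step: "\<And>t. t \<ge> t0 \<Longrightarrow> D (Suc t) \<le> D t - 2 * \<beta> t * (e t + c / 2 * D t) + 2 * (\<beta> t)\<^sup>2 * B"
    and upper: "\<And>t. t \<ge> 1 \<Longrightarrow> e t \<le> H - c / 2 * D t"
    and t0: "t0 \<ge> 1" "t0 = 1 \<or> real t0 * H \<le> 4 * B / c"
    and T: "T \<ge> 1" and \<mu>: "\<And>t. t \<in> {1..T} \<Longrightarrow> \<mu> \<le> e t"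
  shows "\<mu> \<le> 4 / (c * (real T + 1)) * B"
proof -
  have "(real T + 1) * \<mu> \<le> 4 * B / c"
  \<comment> \<open>If the horizon ends before \<open>t0\<close>, the first iterate suffices:
    \<open>\<mu> \<le> e 1 \<le> H\<close> and \<open>T + 1 \<le> t0\<close>.\<close>
  proof (cases "T < t0")
    case True
    then have t: "real t0 * H \<le> 4 * B / c" "real T + 1 \<le> real t0" using T t0 by auto
    have "\<mu> \<le> H"
    proof -
      have "\<mu> \<le> e 1" "e 1 \<le> H - c / 2 * D 1" using \<mu> upper T by auto
      moreover have "0 \<le> c / 2 * D 1" using c D[of 1] by (intro mult_nonneg_nonneg) auto
      ultimately show ?thesis by linarith
    qed
    show ?thesis
    proof (cases "\<mu> \<le> 0")
      case True
      have "(real T + 1) * \<mu> \<le> 0" using True by (intro mult_nonneg_nonpos) auto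
      also have "0 \<le> 4 * B / c" using B c by simp
      finally show ?thesis .
    next
      case False
      have "(real T + 1) * \<mu> \<le> real t0 * H"
        using t(2) \<open>\<mu> \<le> H\<close> False by (intro mult_mono) auto
      then show ?thesis using t(1) by linarith
    qed
  next
    case False
    \<comment> \<open>\<open>t * (t - 1) / 2\<close> is the sum of the weights 1 to
      \<open>t - 1\<close>, so the situation after iteration \<open>T\<close> is the invariant at
      \<open>Suc T\<close>.\<close>
    have inv: "real t * (real t - 1) / 2 * \<mu> + c * real t * (real t - 1) / 4 * D t \<le> 2 * (real t - 1) * B / c"
      if "t0 \<le> t" "t \<le> Suc T" for t
      using that
    proof (induction t rule: dec_induct)
      \<comment> \<open>\<open>upper\<close> enters with weight \<open>t0 * (t0 - 1) / 2\<close>,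
        which makes its distance term cancel exactly against that of the invariant. For
        \<open>t0 = 1\<close> both sides are 0.\<close>
      case base
      have "\<mu> \<le> H - c / 2 * D t0"
        using \<mu>[of t0] upper[of t0] False t0 by force
      then have "real t0 * (real t0 - 1) / 2 * \<mu> \<le> real t0 * (real t0 - 1) / 2 * (H - c / 2 * D t0)"
        using t0 by (intro mult_left_mono) auto
      moreover have "real t0 * (real t0 - 1) / 2 * (H - c / 2 * D t0) + c * real t0 * (real t0 - 1) / 4 * D t0
          = (real t0 - 1) / 2 * (real t0 * H)"
        by (simp add: field_simps)
      moreover have "(real t0 - 1) / 2 * (real t0 * H) \<le> (real t0 - 1) / 2 * (4 * B / c)"
      proof (cases "t0 = 1")
        case False
        then show ?thesis using t0 by (intro mult_left_mono) auto
      qed simp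
      moreover have "(real t0 - 1) / 2 * (4 * B / c) = 2 * (real t0 - 1) * B / c"
        by simp
      ultimately show ?case by linarith
    next
      case (step t)
      then have t: "t \<ge> 1" "t0 \<le> t" "t \<in> {1..T}" and
        IH: "real t * (real t - 1) / 2 * \<mu> + c * real t * (real t - 1) / 4 * D t \<le> 2 * (real t - 1) * B / c"
        using t0 by auto
      have "c * real t * (real t + 1) / 4 * D (Suc t)
          \<le> c * real t * (real t + 1) / 4 * (D t - 2 * \<beta> t * (e t + c / 2 * D t) + 2 * (\<beta> t)\<^sup>2 * B)"
        using assms(5)[OF t(2)] c by (intro mult_left_mono) auto
      also have "\<dots> = c * real t * (real t + 1) / 4 * D t
          - real t / 2 * (\<beta> t * (c * (real t + 1))) * (e t + c / 2 * D t)
          + real t / 2 * (\<beta> t * (c * (real t + 1))) * (\<beta> t * B)"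
        by (simp add: field_simps power2_eq_square)
      also have "\<beta> t * (c * (real t + 1)) = 2"
        unfolding \<beta> using c by simp
      also have "c * real t * (real t + 1) / 4 * D t - real t / 2 * 2 * (e t + c / 2 * D t) + real t / 2 * 2 * (\<beta> t * B)
          = c * real t * (real t + 1) / 4 * D t - real t * e t - c * real t / 2 * D t + real t * (\<beta> t * B)"
        by (simp add: algebra_simps)
      also have "real t * (\<beta> t * B) = real t / (real t + 1) * (2 * B / c)"
        unfolding \<beta> by (simp add: mult_ac)
      also have "c * real t * (real t + 1) / 4 * D t - real t * e t - c * real t / 2 * D t
          + real t / (real t + 1) * (2 * B / c)
          = c * real t * (real t - 1) / 4 * D t - real t * e t + real t / (real t + 1) * (2 * B / c)"
        by (simp add: field_simps)
      also have "\<dots> \<le> c * real t * (real t - 1) / 4 * D t - real t * \<mu> + 1 * (2 * B / c)"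
        using \<mu>[OF t(3)] B c by (intro add_mono diff_left_mono mult_left_mono mult_right_mono) auto
      finally have "real t * \<mu> + c * real t * (real t + 1) / 4 * D (Suc t)
          \<le> c * real t * (real t - 1) / 4 * D t + 2 * B / c"
        by simp
      with IH have "real t * (real t - 1) / 2 * \<mu> + real t * \<mu> + c * real t * (real t + 1) / 4 * D (Suc t)
          \<le> 2 * (real t - 1) * B / c + 2 * B / c"
        by linarith
      moreover have "real t * (real t - 1) / 2 * \<mu> + real t * \<mu> = real t * (real t + 1) / 2 * \<mu>"
        by (simp add: field_simps)
      moreover have "2 * (real t - 1) * B / c + 2 * B / c = 2 * real t * B / c"
        using c by (simp add: field_simps)
      ultimately have "real t * (real t + 1) / 2 * \<mu> + c * real t * (real t + 1) / 4 * D (Suc t)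
          \<le> 2 * real t * B / c"
        by linarith
      then show ?case
        by (simp add: mult_ac add_ac)
    qed
    have "0 \<le> c * real (Suc T) * (real (Suc T) - 1) / 4 * D (Suc T)"
      using c D by simp
    then have "real (Suc T) * (real (Suc T) - 1) / 2 * \<mu> \<le> 2 * (real (Suc T) - 1) * B / c"
      using inv[of "Suc T"] False by linarith
    then have "real T * ((real T + 1) * \<mu>) \<le> real T * (4 * B / c)"
      by (simp add: algebra_simps)
    then show ?thesis
      by (rule mult_left_le_imp_le) (use T in simp)
  qed
  then have "\<mu> \<le> 4 * B / c / (real T + 1)"
    by (subst pos_le_divide_eq) (simp_all add: mult.commute)
  then show ?thesis by (simp add: mult.commute)
qed

text \<open>Here \<open>q\<close> stands for a gradient norm at distance \<open>r\<close> from a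
  feasible point. If \<open>m \<le> \<Gamma>\<close>, both \<open>m\<close> and
  \<open>sqrt Gbar * m\<close> are at most \<open>\<Gamma>\<close>, so the larger of 1 and
  \<open>sqrt Gbar\<close> is an admissible rate. Otherwise \<open>Gbar < 1\<close>, and
  \<open>q\<^sup>2 \<le> G + Gbar * q\<^sup>2\<close> by itself forces \<open>q \<le> m\<close>, so
  there is no growth.\<close>

lemma growth_rate_exists:
  fixes G Gbar m L \<Gamma> :: real
  assumes G: "G > 0" "Gbar > 0" and m: "m \<ge> 0" and L: "L \<ge> 0" and \<Gamma>: "\<Gamma> = sqrt (G + Gbar * m\<^sup>2)"
  obtains \<sigma> where "\<sigma> \<ge> 0" "\<sigma> * m \<le> \<Gamma>"
    and "\<And>q r. q \<ge> 0 \<Longrightarrow> r \<ge> 0 \<Longrightarrow> q \<le> m + L * r \<Longrightarrow> q\<^sup>2 \<le> G + Gbar * q\<^sup>2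
      \<Longrightarrow> G + Gbar * q\<^sup>2 \<le> (\<Gamma> + \<sigma> * L * r)\<^sup>2"
proof (cases "m \<le> \<Gamma>")
  case True
  define s where "s = sqrt Gbar"
  define \<sigma> where "\<sigma> = max 1 s"
  have s: "s \<ge> 0" "s\<^sup>2 = Gbar" "s \<le> \<sigma>" and \<Gamma>2: "\<Gamma>\<^sup>2 = G + Gbar * m\<^sup>2" "\<Gamma> \<ge> 0"
    using G by (simp_all add: s_def \<sigma>_def \<Gamma>)
  have "(s * m)\<^sup>2 \<le> \<Gamma>\<^sup>2"
    using G s \<Gamma>2 by (simp add: power_mult_distrib)
  then have sm: "s * m \<le> \<Gamma>"
    using \<Gamma>2(2) by (rule power2_le_imp_le)
  show thesis
  proof (rule that[of \<sigma>])
    show "\<sigma> \<ge> 0" "\<sigma> * m \<le> \<Gamma>"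
      using True sm by (auto simp: \<sigma>_def max_def)
    fix q r :: real assume q: "q \<ge> 0" "r \<ge> 0" "q \<le> m + L * r"
    have "G + Gbar * q\<^sup>2 \<le> G + Gbar * (m + L * r)\<^sup>2"
      using q G by (intro add_left_mono mult_left_mono power_mono) auto
    also have "\<dots> = \<Gamma>\<^sup>2 + 2 * ((s * m) * (s * (L * r))) + (s * (L * r))\<^sup>2"
      using \<Gamma>2 s by (simp add: power2_eq_square algebra_simps)
    also have "\<dots> \<le> \<Gamma>\<^sup>2 + 2 * (\<Gamma> * (\<sigma> * (L * r))) + (\<sigma> * (L * r))\<^sup>2"
      using s sm q L m \<Gamma>2 by (intro add_mono mult_left_mono mult_mono mult_right_mono power_mono order_refl) auto
    also have "\<dots> = (\<Gamma> + \<sigma> * L * r)\<^sup>2"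
      by (simp add: power2_eq_square algebra_simps)
    finally show "G + Gbar * q\<^sup>2 \<le> (\<Gamma> + \<sigma> * L * r)\<^sup>2" .
  qed
next
  case False
  have \<Gamma>2: "\<Gamma>\<^sup>2 = G + Gbar * m\<^sup>2" "\<Gamma> \<ge> 0"
    using G by (simp_all add: \<Gamma>)
  then have "\<Gamma>\<^sup>2 < m\<^sup>2"
    using False by (intro power_strict_mono) auto
  then have *: "G < (1 - Gbar) * m\<^sup>2"
    using \<Gamma>2 by (simp add: algebra_simps)
  then have "Gbar < 1"
    using G by (smt (verit) mult_nonpos_nonneg zero_le_power2)
  show thesis
  proof (rule that[of 0])
    fix q r :: real assume "q\<^sup>2 \<le> G + Gbar * q\<^sup>2"
    then have "(1 - Gbar) * q\<^sup>2 < (1 - Gbar) * m\<^sup>2"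
      using * by (simp add: algebra_simps)
    then have "q\<^sup>2 \<le> m\<^sup>2"
      using \<open>Gbar < 1\<close> by simp
    then show "G + Gbar * q\<^sup>2 \<le> (\<Gamma> + 0 * L * r)\<^sup>2"
      using G \<Gamma>2 by simp
  qed (use \<Gamma>2 in auto)
qed

section \<open>Convergence rate\<close>

text \<open>Jensen: the squared norm of the mean is at most the second moment. This supplies the
  self-bounding premise of \<open>growth_rate_exists\<close>.\<close>

lemma (in prob_space) stochastic_gradient_norm_le:
  assumes "stochastic_gradient_at M \<xi> g df G Gbar v"
  shows "(norm (df v))\<^sup>2 \<le> G + Gbar * (norm (df v))\<^sup>2"
proof -
  from assms have int: "integrable M (\<lambda>\<omega>. g v (\<xi> \<omega>))" and eq: "(\<integral>\<omega>. g v (\<xi> \<omega>) \<partial>M) = df v"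
    and int2: "integrable M (\<lambda>\<omega>. (norm (g v (\<xi> \<omega>)))\<^sup>2)"
    and le: "(\<integral>\<omega>. (norm (g v (\<xi> \<omega>)))\<^sup>2 \<partial>M) \<le> G + Gbar * (norm (df v))\<^sup>2"
    by (auto simp: stochastic_gradient_at_def)
  have [measurable]: "(\<lambda>\<omega>. g v (\<xi> \<omega>)) \<in> borel_measurable M"
    using int by (rule borel_measurable_integrable)
  let ?E = "\<integral>\<omega>. (norm (g v (\<xi> \<omega>)))\<^sup>2 \<partial>M"
  have E: "?E \<ge> 0" by simp
  have "norm (df v) \<le> (\<integral>\<omega>. norm (g v (\<xi> \<omega>)) * 1 \<partial>M)"
    unfolding eq[symmetric] by simp
  also have "\<dots> \<le> sqrt ?E * 1"
    using int2 E by (intro Cauchy_Schwarz_integral(2)) (simp_all add: prob_space)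
  finally have "(norm (df v))\<^sup>2 \<le> (sqrt ?E)\<^sup>2"
    by (intro power_mono) auto
  then show ?thesis using E le by simp
qed

theorem theorem3p1:
  fixes X :: "(real ^ 'n) set"
    and f :: "objective \<Rightarrow> real ^ 'n \<Rightarrow> real"
    and df :: "objective \<Rightarrow> real ^ 'n \<Rightarrow> real ^ 'n"
    and n :: "objective \<Rightarrow> nat"
    and L\<^sub>i M\<^sub>i c\<^sub>i G\<^sub>i Gbar\<^sub>i :: "objective \<Rightarrow> real"
    and \<Theta> c L G Gbar Mgrad Ghat lam :: real
    and \<alpha> :: "nat \<Rightarrow> real"
    and P :: "'w measure" and Z :: "'z measure"
    and \<xi> :: "nat \<Rightarrow> nat \<Rightarrow> 'w \<Rightarrow> 'z"
    and g :: "objective \<Rightarrow> real ^ 'n \<Rightarrow> 'z \<Rightarrow> real ^ 'n"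
    and x0 xstar :: "real ^ 'n"
    and x :: "nat \<Rightarrow> 'w \<Rightarrow> real ^ 'n"
    and y :: "objective \<Rightarrow> nat \<Rightarrow> nat \<Rightarrow> 'w \<Rightarrow> real ^ 'n"
    and T :: nat
  assumes X: "X \<noteq> {}" "compact X" "convex X"
    and C1: "\<And>i v. GDERIV (f i) v :> df i v" "\<And>i. continuous_on UNIV (df i)"
    and n_pos: "\<And>i. n i \<ge> 1"
    and bounded_region: "\<Theta> > 0" "\<And>v w. v \<in> X \<Longrightarrow> w \<in> X \<Longrightarrow> norm (v - w) \<le> \<Theta>"
    and lipschitz: "\<And>i. L\<^sub>i i > 0"
      "\<And>i v w. v \<in> X \<Longrightarrow> w \<in> X \<Longrightarrow> norm (df i v - df i w) \<le> L\<^sub>i i * norm (v - w)"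
    and gradient_bound: "\<And>i. M\<^sub>i i > 0" "\<And>i v. v \<in> X \<Longrightarrow> (norm (df i v))\<^sup>2 \<le> M\<^sub>i i"
    and strongly_convex: "\<And>i. c\<^sub>i i > 0"
      "\<And>i v w. v \<in> X \<Longrightarrow> w \<in> X \<Longrightarrow>
         f i w \<ge> f i v + df i v \<bullet> (w - v) + c\<^sub>i i / 2 * (norm (w - v))\<^sup>2"
    and prob: "prob_space P"
    and g_measurable: "\<And>i. (\<lambda>(v, z). g i v z) \<in> borel_measurable (borel \<Otimes>\<^sub>M Z)"
    and \<xi>_indep: "prob_space.indep_vars P (\<lambda>_. Z) (\<lambda>(t, r). \<xi> t r)
                   (UNIV \<times> {..<n Obj_a + n Obj_b})"
    and algorithm: "\<And>\<omega>. \<omega> \<in> space P \<Longrightarrow>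
         sa2gd_run X g n \<alpha> (\<lambda>t r. \<xi> t r \<omega>) x0 (\<lambda>t. x t \<omega>) (\<lambda>i t r. y i t r \<omega>)"
    and moments_pos: "\<And>i. G\<^sub>i i > 0" "\<And>i. Gbar\<^sub>i i > 0"
    and stochastic_gradient_a: "AE \<omega> in P. \<forall>t. \<forall>r<n Obj_a.
         stochastic_gradient_at P (\<xi> t r) (g Obj_a) (df Obj_a)
           (G\<^sub>i Obj_a) (Gbar\<^sub>i Obj_a) (y Obj_a t r \<omega>)"
    and stochastic_gradient_b: "AE \<omega> in P. \<forall>t. \<forall>r<n Obj_b.
         stochastic_gradient_at P (\<xi> t (n Obj_a + r)) (g Obj_b) (df Obj_b)
           (G\<^sub>i Obj_b) (Gbar\<^sub>i Obj_b) (y Obj_b t r \<omega>)"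
    (* The inner iterates may lie outside X; the Lipschitz bound is needed between X and
       the points where gradients are sampled. *)
    and lipschitz_inner: "\<And>i. AE \<omega> in P. \<forall>t. \<forall>r<n i. \<forall>v\<in>X.
         norm (df i (y i t r \<omega>) - df i v) \<le> L\<^sub>i i * norm (y i t r \<omega> - v)"
    and lam: "lam = real (n Obj_a) / real (n Obj_a + n Obj_b)"
    and xstar: "is_arg_min (\<lambda>v. weighted_sum f v lam) (\<lambda>v. v \<in> X) xstar"
    and c: "c = min (c\<^sub>i Obj_a) (c\<^sub>i Obj_b)"
    and L: "L = max (L\<^sub>i Obj_a) (L\<^sub>i Obj_b)"
    and G: "G = max (G\<^sub>i Obj_a) (G\<^sub>i Obj_b)"
    and Gbar: "Gbar = max (Gbar\<^sub>i Obj_a) (Gbar\<^sub>i Obj_b)"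
    and Mgrad: "Mgrad = max (M\<^sub>i Obj_a) (M\<^sub>i Obj_b)"
    and Ghat: "Ghat = sqrt (G + Gbar * Mgrad)"
    and \<alpha>: "\<And>t. \<alpha> t = 2 / (c * (real t + 1) * real (n Obj_a + n Obj_b))"
    and T: "T \<ge> 1"
  shows "Min ((\<lambda>t. \<integral>\<omega>. weighted_sum f (x t \<omega>) lam \<partial>P) ` {1..T}) - weighted_sum f xstar lam
           \<le> 4 / (c * (real T + 1)) * (Ghat\<^sup>2 + L * \<Theta> * Ghat)"
proof -

  \<comment> \<open>Notation and constants\<close>
  interpret prob_space P by (rule prob)
  define N where "N = n Obj_a + n Obj_b"
  define m where "m = sqrt Mgrad"
  define B where "B = Ghat\<^sup>2 + L * \<Theta> * Ghat"
  \<comment> \<open>Both loops become one pass. At \<open>k = n Obj_a\<close> the point is still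
    read off the first loop, but the gradient step taken from it already belongs to
    \<open>Obj_b\<close>; hence \<open><\<close> in \<open>i\<close> and \<open>\<le>\<close> in
    \<open>u\<close>.\<close>
  define i where "i = (\<lambda>k. if k < n Obj_a then Obj_a else Obj_b)"
  define u where "u = (\<lambda>t k \<omega>. if k \<le> n Obj_a then y Obj_a t k \<omega> else y Obj_b t (k - n Obj_a) \<omega>)"
  define S where "S = (\<lambda>v. weighted_sum f v lam)"
  \<comment> \<open>Indices of the samples drawn before step \<open>k\<close> of iteration
    \<open>t\<close>, in lexicographic order.\<close>
  define past where "past = (\<lambda>(t::nat) k. {(t', r). (t' < t \<or> t' = t \<and> r < k) \<and> r < N})"
  define F where "F = (\<lambda>t k. history P Z (\<lambda>(t, r). \<xi> t r) (past t k))"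

  have N: "N \<ge> 1" using n_pos[of Obj_a] by (simp add: N_def)
  have pos: "c > 0" "L > 0" "G > 0" "Gbar > 0" "Mgrad > 0" "m > 0"
    using strongly_convex(1) lipschitz(1) moments_pos gradient_bound(1)
    by (simp_all add: c L G Gbar Mgrad m_def less_max_iff_disj)
  have i_le: "c \<le> c\<^sub>i j" "L\<^sub>i j \<le> L" "G\<^sub>i j \<le> G" "Gbar\<^sub>i j \<le> Gbar" "M\<^sub>i j \<le> Mgrad" for j
    by (cases j; simp add: c L G Gbar Mgrad)+
  have Ghat_nonneg: "Ghat \<ge> 0" using pos by (simp add: Ghat)
  have Ghat_m: "Ghat = sqrt (G + Gbar * m\<^sup>2)" using pos by (simp add: Ghat m_def)
  have B: "B \<ge> 0" using pos bounded_region(1) Ghat_nonneg by (simp add: B_def)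
  have df_bound: "norm (df j v) \<le> m" if "v \<in> X" for j v
    using gradient_bound(2)[OF that, of j] i_le(5)[of j] unfolding m_def
    by (intro real_le_rsqrt) linarith
  have \<alpha>_pos: "\<alpha> t > 0" for t
    using pos N by (simp add: \<alpha> N_def)
  have \<alpha>_N: "\<alpha> t * real N = 2 / (c * (real t + 1))" for t
    unfolding \<alpha> N_def[symmetric] using N by simp
  have closed_X: "closed X" using X(2) by (rule compact_imp_closed)
  have xstar_X: "xstar \<in> X" using xstar by (simp add: is_arg_min_def)

  \<comment> \<open>The algorithm as a single pass per iteration\<close>
  have run: "x 0 \<omega> = x0" "u t 0 \<omega> = x t \<omega>" "x (Suc t) \<omega> = closest_point X (u t N \<omega>)"
    "k < N \<Longrightarrow> u t (Suc k) \<omega> = u t k \<omega> - \<alpha> t *\<^sub>R g (i k) (u t k \<omega>) (\<xi> t k \<omega>)"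
    "k \<ge> n Obj_a \<Longrightarrow> u t k \<omega> = y Obj_b t (k - n Obj_a) \<omega>"
    if "\<omega> \<in> space P" for t k \<omega>
  proof -
    note alg = algorithm[OF that, unfolded sa2gd_run_def]
    show "x 0 \<omega> = x0" "u t 0 \<omega> = x t \<omega>" using alg by (simp_all add: u_def)
    show u_b: "u t k \<omega> = y Obj_b t (k - n Obj_a) \<omega>" if "k \<ge> n Obj_a" for k
      using alg that by (cases "k = n Obj_a") (simp_all add: u_def)
    show "x (Suc t) \<omega> = closest_point X (u t N \<omega>)"
      using alg u_b[of N] by (simp add: N_def)
    show "u t (Suc k) \<omega> = u t k \<omega> - \<alpha> t *\<^sub>R g (i k) (u t k \<omega>) (\<xi> t k \<omega>)" if "k < N"
    proof (cases "k < n Obj_a")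
      case True
      then show ?thesis using alg by (simp add: u_def i_def)
    next
      case False
      then have "k - n Obj_a < n Obj_b" "n Obj_a + (k - n Obj_a) = k"
        using that by (simp_all add: N_def)
      then show ?thesis
        using alg False u_b[of k] u_b[of "Suc k"] by (simp add: i_def Suc_diff_le)
    qed
  qed
  \<comment> \<open>The starting point is arbitrary and only projected iterates are known to be
    feasible, so the estimates begin at \<open>t = 1\<close>.\<close>
  have x_X: "x t \<omega> \<in> X" if "t \<ge> 1" "\<omega> \<in> space P" for t \<omega>
    using run(3)[OF that(2), of "t - 1"] closest_point_in_set[OF closed_X X(1)] that(1) by simp

  \<comment> \<open>Regularity of the objectives\<close>
  have f_cont: "continuous_on A (f j)" for j A
  proof (rule differentiable_imp_continuous_on)
    show "f j differentiable_on A"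
      using C1(1)[of j] unfolding gderiv_def differentiable_on_def
      by (blast intro: differentiableI has_derivative_at_withinI)
  qed
  have S_cont: "continuous_on A S" for A
    unfolding S_def weighted_sum_def by (intro continuous_intros f_cont)
  have [measurable]: "S \<in> borel_measurable borel" "\<And>j. df j \<in> borel_measurable borel"
    using S_cont C1(2) by (auto intro: borel_measurable_continuous_onI)
  note [measurable] = g_measurable

  \<comment> \<open>Iterates as functions of the past samples\<close>
  have \<xi>_meas [measurable]: "\<xi> t k \<in> measurable P Z" if "k < N" for t k
    using \<xi>_indep that by (auto simp: indep_vars_def N_def)
  have \<xi>_space: "(\<lambda>(t, r). \<xi> t r) j \<in> space P \<rightarrow> space Z" if "j \<in> past t k" for j t k
    using that measurable_space[OF \<xi>_meas] by (auto simp: past_def)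
  have past_I: "past t k \<subseteq> UNIV \<times> {..<n Obj_a + n Obj_b}" for t k
    by (auto simp: past_def N_def)
  have F_mono: "W \<in> measurable (F t' k') borel"
    if "W \<in> measurable (F t k) borel" "past t k \<subseteq> past t' k'" for W :: "'w \<Rightarrow> real ^ 'n" and t k t' k'
    using that unfolding F_def by (rule history_mono[OF _ _ \<xi>_space])
  \<comment> \<open>The sample \<open>\<xi> t k\<close> enters the history only at
    \<open>Suc k\<close>, exactly when it is first used.\<close>
  have u_F: "u t k \<in> measurable (F t k) borel" if "x t \<in> measurable (F t 0) borel" "k \<le> N" for t k
    using that(2)
  proof (induction k)
    case 0
    have "u t 0 \<in> measurable (F t 0) borel \<longleftrightarrow> x t \<in> measurable (F t 0) borel"
      by (rule measurable_cong) (simp add: F_def run(2))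
    then show ?case using that(1) by simp
  next
    case (Suc k)
    then have k: "k < N" by simp
    have [measurable]: "u t k \<in> measurable (F t (Suc k)) borel"
      using Suc by (intro F_mono[OF Suc.IH]) (auto simp: past_def)
    have [measurable]: "\<xi> t k \<in> measurable (F t (Suc k)) Z"
      using history_component[of "(t, k)" "past t (Suc k)" "\<lambda>(t, r). \<xi> t r" P Z] \<xi>_space k
      unfolding F_def by (force simp: past_def)
    have "(\<lambda>\<omega>. (\<lambda>(v, s). g (i k) v s) (u t k \<omega>, \<xi> t k \<omega>)) \<in> borel_measurable (F t (Suc k))"
      by measurable
    then have [measurable]: "(\<lambda>\<omega>. g (i k) (u t k \<omega>) (\<xi> t k \<omega>)) \<in> borel_measurable (F t (Suc k))"
      by simp
    have "u t (Suc k) \<in> borel_measurable (F t (Suc k)) \<longleftrightarrow>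
        (\<lambda>\<omega>. u t k \<omega> - \<alpha> t *\<^sub>R g (i k) (u t k \<omega>) (\<xi> t k \<omega>)) \<in> borel_measurable (F t (Suc k))"
      by (rule measurable_cong) (simp add: F_def run(4)[OF _ k])
    then show ?case by simp
  qed
  have x_F: "x t \<in> measurable (F t 0) borel" for t
  proof (induction t)
    case 0
    have "x 0 \<in> measurable (F 0 0) borel \<longleftrightarrow> (\<lambda>_. x0) \<in> measurable (F 0 0) borel"
      by (rule measurable_cong) (simp add: F_def run(1))
    then show ?case by simp
  next
    case (Suc t)
    have [measurable]: "u t N \<in> measurable (F (Suc t) 0) borel"
      by (rule F_mono[OF u_F[OF Suc order_refl]]) (auto simp: past_def)
    have [measurable]: "closest_point X \<in> borel_measurable borel"
      by (intro borel_measurable_continuous_onI continuous_on_closest_point X closed_X)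
    have "x (Suc t) \<in> measurable (F (Suc t) 0) borel \<longleftrightarrow>
        (\<lambda>\<omega>. closest_point X (u t N \<omega>)) \<in> measurable (F (Suc t) 0) borel"
      by (rule measurable_cong) (simp add: F_def run(3))
    then show ?case by simp
  qed
  have xu_F: "(\<lambda>\<omega>. (x t \<omega>, u t k \<omega>)) \<in> measurable (F t k) (borel \<Otimes>\<^sub>M borel)" if "k \<le> N" for t k
  proof -
    have [measurable]: "x t \<in> measurable (F t k) borel"
      by (rule F_mono[OF x_F]) (auto simp: past_def)
    note [measurable] = u_F[OF x_F that]
    show ?thesis by measurable
  qed
  have x_meas [measurable]: "x t \<in> borel_measurable P" for t
    by (rule measurable_history[OF \<xi>_indep past_I x_F[unfolded F_def]])
  \<comment> \<open>The index \<open>(t, k)\<close> is not in \<open>past t k\<close>, so the sample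
    is fresh for everything computed up to this step.\<close>
  have independent: "distr P (borel \<Otimes>\<^sub>M borel) (\<lambda>\<omega>. (x t \<omega>, u t k \<omega>)) \<Otimes>\<^sub>M distr P Z (\<xi> t k)
      = distr P ((borel \<Otimes>\<^sub>M borel) \<Otimes>\<^sub>M Z) (\<lambda>\<omega>. ((x t \<omega>, u t k \<omega>), \<xi> t k \<omega>))" if "k < N" for t k
    using product_distr_history[OF \<xi>_indep past_I, of "(t, k)" t k "\<lambda>\<omega>. (x t \<omega>, u t k \<omega>)" "borel \<Otimes>\<^sub>M borel"]
      xu_F[of k t] that by (simp add: F_def past_def N_def)

  \<comment> \<open>Gradient conditions along the merged pass\<close>
  have sampled: "AE \<omega> in P. stochastic_gradient_at P (\<xi> t k) (g (i k)) (df (i k))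
      (G\<^sub>i (i k)) (Gbar\<^sub>i (i k)) (u t k \<omega>)" if "k < N" for t k
  proof (cases "k < n Obj_a")
    case True
    show ?thesis
      using stochastic_gradient_a by eventually_elim (use True in \<open>simp add: i_def u_def\<close>)
  next
    case False
    then have k: "k - n Obj_a < n Obj_b" "n Obj_a + (k - n Obj_a) = k"
      using that by (simp_all add: N_def)
    show ?thesis
      using stochastic_gradient_b AE_space
    proof eventually_elim
      case (elim \<omega>)
      from elim(1)[rule_format, OF k(1), of t] show ?case
        using False run(5)[OF elim(2), of k t] k(2) by (simp add: i_def)
    qed
  qed
  have lip: "AE \<omega> in P. norm (df (i k) (u t k \<omega>) - df (i k) (x t \<omega>)) \<le> L * norm (u t k \<omega> - x t \<omega>)"
    if k: "k < N" and t: "t \<ge> 1" for t k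
    using lipschitz_inner[of "i k"] AE_space
  proof eventually_elim
    case (elim \<omega>)
    have "norm (df (i k) (u t k \<omega>) - df (i k) (x t \<omega>)) \<le> L\<^sub>i (i k) * norm (u t k \<omega> - x t \<omega>)"
    proof (cases "k < n Obj_a")
      case True
      then show ?thesis
        using elim(1)[rule_format, of k "x t \<omega>" t] x_X[OF t elim(2)] by (simp add: i_def u_def)
    next
      case False
      then show ?thesis
        using elim(1)[rule_format, of "k - n Obj_a" "x t \<omega>" t] x_X[OF t elim(2)] k
          run(5)[OF elim(2), of k t] by (simp add: i_def N_def less_diff_conv2)
    qed
    also have "\<dots> \<le> L * norm (u t k \<omega> - x t \<omega>)"
      by (intro mult_right_mono i_le) simp
    finally show ?case .
  qed

  \<comment> \<open>The threshold between early and late iterations\<close>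
  obtain \<sigma> where \<sigma>: "\<sigma> \<ge> 0" "\<sigma> * m \<le> Ghat"
    and growth: "\<And>q r. q \<ge> 0 \<Longrightarrow> r \<ge> 0 \<Longrightarrow> q \<le> m + L * r \<Longrightarrow> q\<^sup>2 \<le> G + Gbar * q\<^sup>2
      \<Longrightarrow> G + Gbar * q\<^sup>2 \<le> (Ghat + \<sigma> * L * r)\<^sup>2"
    using growth_rate_exists[OF pos(3,4) less_imp_le[OF pos(6)] less_imp_le[OF pos(2)] Ghat_m] by metis
  \<comment> \<open>The floor serves both regimes: \<open>t \<ge> t0\<close> gives
    \<open>t + 1 > 4 * L * \<sigma> / c\<close>, hence small steps, while
    \<open>t0 \<le> 4 * L * \<sigma> / c\<close> unless \<open>t0 = 1\<close>. The maximum with 1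
    excludes the possibly infeasible start.\<close>
  define t0 where "t0 = max 1 (nat \<lfloor>4 * L * \<sigma> / c\<rfloor>)"
  have t0_small: "t0 = 1 \<or> real t0 * (m * \<Theta>) \<le> 4 * B / c"
  proof (cases "t0 = 1")
    case False
    then have "real t0 \<le> 4 * L * \<sigma> / c"
      unfolding t0_def by (auto simp: max_def split: if_splits) linarith
    then have "real t0 * (m * \<Theta>) \<le> 4 * L * \<sigma> / c * (m * \<Theta>)"
      using pos bounded_region(1) by (intro mult_right_mono) auto
    also have "\<dots> = 4 * (L * \<Theta> * (\<sigma> * m)) / c"
      by simp
    also have "\<dots> \<le> 4 * (L * \<Theta> * Ghat) / c"
      using pos bounded_region(1) \<sigma> by (intro divide_right_mono mult_left_mono) auto
    also have "\<dots> \<le> 4 * B / c"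
      using pos by (intro divide_right_mono) (auto simp: B_def)
    finally show ?thesis ..
  qed simp
  have small: "\<alpha> t * (\<sigma> * L) * real N \<le> 1 / 2" if "t \<ge> t0" for t
  proof -
    have "4 * L * \<sigma> / c < real_of_int \<lfloor>4 * L * \<sigma> / c\<rfloor> + 1"
      by linarith
    also have "\<dots> \<le> real t + 1"
      using that unfolding t0_def by linarith
    finally have "4 * L * \<sigma> \<le> c * (real t + 1)"
      using pos by (simp add: field_simps)
    moreover have "0 < c * (real t + 1)"
      using pos by (intro mult_pos_pos) auto
    ultimately have "(4 * L * \<sigma>) / (c * (real t + 1)) \<le> 1"
      by (subst divide_le_eq_1_pos)
    then have "2 / (c * (real t + 1)) * (\<sigma> * L) \<le> 1 / 2"
      by (simp add: mult_ac)
    then show ?thesis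
      using \<alpha>_N[of t] by (simp add: mult_ac)
  qed

  \<comment> \<open>Strong convexity of the weighted sum, in expectation\<close>
  define e where "e = (\<lambda>t. (\<integral>\<omega>. S (x t \<omega>) \<partial>P) - S xstar)"
  define D where "D = (\<lambda>t. \<integral>\<omega>. (norm (x t \<omega> - xstar))\<^sup>2 \<partial>P)"
  define dS where "dS = (\<lambda>v. lam *\<^sub>R df Obj_a v + (1 - lam) *\<^sub>R df Obj_b v)"
  have lam01: "0 \<le> lam" "lam \<le> 1" "real N * lam = real (n Obj_a)" "real N * (1 - lam) = real (n Obj_b)"
    using N by (simp_all add: lam N_def field_simps)
  \<comment> \<open>This is where the weight \<open>lam\<close> comes from: a pass takes
    \<open>n Obj_a\<close> steps for one objective and \<open>n Obj_b\<close> for the other, so its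
    gradients at a common point add up to \<open>N\<close> times that of the weighted sum.\<close>
  have sum_df: "(\<Sum>k<N. df (i k) v) = real N *\<^sub>R dS v" for v
  proof -
    have "(\<Sum>k<N. df (i k) v) = (\<Sum>k<n Obj_a. df (i k) v) + (\<Sum>k=n Obj_a..<N. df (i k) v)"
      by (simp add: N_def lessThan_atLeast0 sum.atLeastLessThan_concat)
    also have "\<dots> = (\<Sum>k<n Obj_a. df Obj_a v) + (\<Sum>k=n Obj_a..<N. df Obj_b v)"
      by (intro arg_cong2[where f = "(+)"] sum.cong) (auto simp: i_def)
    also have "\<dots> = real N *\<^sub>R dS v"
      using lam01(3,4) by (simp add: dS_def scaleR_add_right N_def sum_constant_scaleR del: sum_constant)
    finally show ?thesis .
  qed
  have dS_inner: "dS v \<bullet> w = lam * (df Obj_a v \<bullet> w) + (1 - lam) * (df Obj_b v \<bullet> w)" for v w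
    by (simp add: dS_def inner_add_left)
  \<comment> \<open>Strong convexity of each objective from \<open>v\<close> towards
    \<open>xstar\<close>, with the common modulus \<open>c\<close>, combined with weights
    \<open>lam\<close> and \<open>1 - lam\<close>.\<close>
  have S_sc: "S v - S xstar + c / 2 * (norm (v - xstar))\<^sup>2 \<le> dS v \<bullet> (v - xstar)" if "v \<in> X" for v
  proof -
    have *: "f j v + df j v \<bullet> (xstar - v) + c / 2 * (norm (v - xstar))\<^sup>2 \<le> f j xstar" for j
    proof -
      have "c / 2 * (norm (v - xstar))\<^sup>2 \<le> c\<^sub>i j / 2 * (norm (xstar - v))\<^sup>2"
        unfolding norm_minus_commute[of v xstar] using i_le(1)[of j] by (intro mult_right_mono) auto
      then show ?thesis
        using strongly_convex(2)[OF that xstar_X, of j] by linarith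
    qed
    have "lam * (f Obj_a v + df Obj_a v \<bullet> (xstar - v) + c / 2 * (norm (v - xstar))\<^sup>2)
        + (1 - lam) * (f Obj_b v + df Obj_b v \<bullet> (xstar - v) + c / 2 * (norm (v - xstar))\<^sup>2) \<le> S xstar"
      unfolding S_def weighted_sum_def using lam01 * by (intro add_mono mult_left_mono) auto
    moreover have "lam * (f Obj_a v + df Obj_a v \<bullet> (xstar - v) + c / 2 * (norm (v - xstar))\<^sup>2)
        + (1 - lam) * (f Obj_b v + df Obj_b v \<bullet> (xstar - v) + c / 2 * (norm (v - xstar))\<^sup>2)
        = S v - dS v \<bullet> (v - xstar) + c / 2 * (norm (v - xstar))\<^sup>2"
      by (simp add: S_def weighted_sum_def dS_inner inner_diff_right field_simps)
    ultimately show ?thesis by linarith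
  qed
  have dS_bound: "norm (dS v) \<le> m" if "v \<in> X" for v
  proof -
    have "norm (dS v) \<le> lam * norm (df Obj_a v) + (1 - lam) * norm (df Obj_b v)"
      unfolding dS_def using norm_triangle_ineq[of "lam *\<^sub>R df Obj_a v" "(1 - lam) *\<^sub>R df Obj_b v"] lam01 by simp
    also have "\<dots> \<le> lam * m + (1 - lam) * m"
      using lam01 df_bound[OF that] by (intro add_mono mult_left_mono) auto
    finally show ?thesis by (simp add: algebra_simps)
  qed
  have [measurable]: "dS \<in> borel_measurable borel"
    unfolding dS_def by measurable
  have dS_le: "dS v \<bullet> (v - xstar) \<le> m * \<Theta>" "\<bar>dS v \<bullet> (v - xstar)\<bar> \<le> m * \<Theta>" if "v \<in> X" for v
  proof -
    have "\<bar>dS v \<bullet> (v - xstar)\<bar> \<le> norm (dS v) * norm (v - xstar)"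
      by (rule Cauchy_Schwarz_ineq2)
    also have "\<dots> \<le> m * \<Theta>"
      using dS_bound[OF that] bounded_region(2)[OF that xstar_X] pos by (intro mult_mono) auto
    finally show "\<bar>dS v \<bullet> (v - xstar)\<bar> \<le> m * \<Theta>" .
    then show "dS v \<bullet> (v - xstar) \<le> m * \<Theta>" by linarith
  qed
  have int_D: "integrable P (\<lambda>\<omega>. (norm (x t \<omega> - xstar))\<^sup>2)" if "t \<ge> 1" for t
    by (rule integrable_const_bound[where B = "\<Theta>\<^sup>2"])
      (auto intro!: AE_I2 power_mono bounded_region(2) x_X that xstar_X)
  have int_dS: "integrable P (\<lambda>\<omega>. dS (x t \<omega>) \<bullet> (x t \<omega> - xstar))" if "t \<ge> 1" for t
    by (rule integrable_const_bound[where B = "m * \<Theta>"]) (auto intro!: AE_I2 dS_le(2) x_X that)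
  have int_S: "integrable P (\<lambda>\<omega>. S (x t \<omega>))" if "t \<ge> 1" for t
  proof -
    have "bounded (S ` X)"
      by (intro compact_imp_bounded compact_continuous_image S_cont X)
    then obtain b where "\<forall>v\<in>X. norm (S v) \<le> b"
      by (auto simp: bounded_iff)
    then show ?thesis
      by (intro integrable_const_bound[where B = b]) (auto intro!: AE_I2 x_X that)
  qed
  have sc_mean: "e t + c / 2 * D t \<le> (\<integral>\<omega>. dS (x t \<omega>) \<bullet> (x t \<omega> - xstar) \<partial>P)" if "t \<ge> 1" for t
  proof -
    have "e t + c / 2 * D t = (\<integral>\<omega>. S (x t \<omega>) - S xstar + c / 2 * (norm (x t \<omega> - xstar))\<^sup>2 \<partial>P)"
      using int_S[OF that] int_D[OF that] by (simp add: e_def D_def prob_space)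
    also have "\<dots> \<le> (\<integral>\<omega>. dS (x t \<omega>) \<bullet> (x t \<omega> - xstar) \<partial>P)"
      using int_S[OF that] int_D[OF that] int_dS[OF that] by (intro integral_mono S_sc x_X that) auto
    finally show ?thesis .
  qed
  \<comment> \<open>A bound that ignores the dynamics: the inner product in \<open>sc_mean\<close>
    is at most gradient bound times diameter.\<close>
  have upper: "e t \<le> m * \<Theta> - c / 2 * D t" if "t \<ge> 1" for t
  proof -
    have "(\<integral>\<omega>. dS (x t \<omega>) \<bullet> (x t \<omega> - xstar) \<partial>P) \<le> m * \<Theta>"
      by (rule integral_le_const[OF int_dS[OF that]]) (auto intro!: AE_I2 dS_le(1) x_X that)
    then show ?thesis using sc_mean[OF that] by linarith
  qed

  \<comment> \<open>Recursion for the mean squared distance to the minimizer\<close>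
  have step: "D (Suc t) \<le> D t - 2 * (\<alpha> t * real N) * (e t + c / 2 * D t) + 2 * (\<alpha> t * real N)\<^sup>2 * B"
    if "t \<ge> t0" for t
  proof -
    have t: "t \<ge> 1" using that by (simp add: t0_def)
    note x_t_X = x_X[OF t]
    \<comment> \<open>\<open>Ghat\<close> bounds the root mean square at the feasible start of the
      pass, and \<open>\<sigma> * L\<close> is its growth rate per unit of displacement.\<close>
    interpret pass: sgd_pass P Z "x t" "u t" "\<xi> t" "\<lambda>k. g (i k)" "\<lambda>k. df (i k)" xstar N "\<alpha> t"
      Ghat "\<sigma> * L" L \<Theta> m
    proof unfold_locales
      fix k assume k: "k < N"
      show "AE \<omega> in P. integrable P (\<lambda>\<omega>'. g (i k) (u t k \<omega>) (\<xi> t k \<omega>')) \<and>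
          (\<integral>\<omega>'. g (i k) (u t k \<omega>) (\<xi> t k \<omega>') \<partial>P) = df (i k) (u t k \<omega>)"
        using sampled[OF k, of t] by eventually_elim (simp add: stochastic_gradient_at_def)
      show "AE \<omega> in P. integrable P (\<lambda>\<omega>'. (norm (g (i k) (u t k \<omega>) (\<xi> t k \<omega>')))\<^sup>2) \<and>
          (\<integral>\<omega>'. (norm (g (i k) (u t k \<omega>) (\<xi> t k \<omega>')))\<^sup>2 \<partial>P) \<le> (Ghat + \<sigma> * L * norm (u t k \<omega> - x t \<omega>))\<^sup>2"
        using sampled[OF k, of t] lip[OF k t] AE_space
      proof eventually_elim
        case (elim \<omega>)
        let ?q = "norm (df (i k) (u t k \<omega>))"
        have le: "G\<^sub>i (i k) + Gbar\<^sub>i (i k) * ?q\<^sup>2 \<le> G + Gbar * ?q\<^sup>2"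
          by (intro add_mono mult_right_mono i_le) simp
        have "?q \<le> m + L * norm (u t k \<omega> - x t \<omega>)"
          using norm_triangle_sub[of "df (i k) (u t k \<omega>)" "df (i k) (x t \<omega>)"]
            df_bound[OF x_X[OF t elim(3)], of "i k"] elim(2) by linarith
        moreover have "?q\<^sup>2 \<le> G + Gbar * ?q\<^sup>2"
          using stochastic_gradient_norm_le[OF elim(1)] le by linarith
        ultimately have "G + Gbar * ?q\<^sup>2 \<le> (Ghat + \<sigma> * L * norm (u t k \<omega> - x t \<omega>))\<^sup>2"
          by (intro growth) auto
        with le elim(1) show ?case
          by (auto simp: stochastic_gradient_at_def)
      qed
    qed (use \<alpha>_pos[of t] pos bounded_region(1) Ghat_nonneg \<sigma> small[OF that] independent lip t in
        \<open>auto intro: bounded_region(2) x_t_X xstar_X df_bound simp: run\<close>)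
    \<comment> \<open>The projection is nonexpansive and fixes \<open>xstar\<close>.\<close>
    have "D (Suc t) \<le> (\<integral>\<omega>. (norm (u t N \<omega> - xstar))\<^sup>2 \<partial>P)"
      unfolding D_def
    proof (rule integral_mono[OF int_D pass.pass_bound(1)])
      fix \<omega> assume "\<omega> \<in> space P"
      then show "(norm (x (Suc t) \<omega> - xstar))\<^sup>2 \<le> (norm (u t N \<omega> - xstar))\<^sup>2"
        using closest_point_lipschitz[OF X(3) closed_X X(1), of "u t N \<omega>" xstar]
        by (intro power_mono) (simp_all add: run(3) closest_point_self[OF xstar_X] dist_norm)
    qed simp
    also note pass.pass_bound(2)
    also have "(\<integral>\<omega>. (\<Sum>k<N. df (i k) (x t \<omega>)) \<bullet> (x t \<omega> - xstar) \<partial>P)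
        = real N * (\<integral>\<omega>. dS (x t \<omega>) \<bullet> (x t \<omega> - xstar) \<partial>P)"
      by (simp add: sum_df)
    finally have "D (Suc t) \<le> D t - 2 * (\<alpha> t * real N) * (\<integral>\<omega>. dS (x t \<omega>) \<bullet> (x t \<omega> - xstar) \<partial>P)
        + 2 * (\<alpha> t * real N)\<^sup>2 * B"
      by (simp add: D_def B_def mult.assoc)
    moreover have "2 * (\<alpha> t * real N) * (e t + c / 2 * D t)
        \<le> 2 * (\<alpha> t * real N) * (\<integral>\<omega>. dS (x t \<omega>) \<bullet> (x t \<omega> - xstar) \<partial>P)"
      using \<alpha>_pos[of t] sc_mean[OF t] by (intro mult_left_mono) auto
    ultimately show ?thesis by linarith
  qed

  \<comment> \<open>The rate for the best iterate\<close>
  let ?A = "(\<lambda>t. \<integral>\<omega>. S (x t \<omega>) \<partial>P) ` {1..T}"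
  have "Min ?A - S xstar \<le> 4 / (c * (real T + 1)) * B"
  \<comment> \<open>Here \<open>\<mu>\<close> is the smallest optimality gap, which lies below every
    \<open>e t\<close> with \<open>t\<close> in \<open>{1..T}\<close>, and \<open>H\<close> is
    \<open>m * \<Theta>\<close>.\<close>
  proof (rule weighted_average_bound[where \<beta> = "\<lambda>t. \<alpha> t * real N", OF pos(1) B _ \<alpha>_N step upper _ t0_small T])
    show "D t \<ge> 0" for t by (simp add: D_def)
    show "t0 \<ge> 1" by (simp add: t0_def)
    show "Min ?A - S xstar \<le> e t" if "t \<in> {1..T}" for t
      using that by (simp add: e_def)
  qed
  then show ?thesis
    by (simp add: S_def B_def)
qed

end
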